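(* For any $\theta\in[-1,1]$, a 2D symmetric OCAD on $\Omega=[-1,1]^2$, both for $\mathbb P^6$ and for $\mathbb P^7$, is given by $$\langle p\rangle_\Omega=\overline\omega_\star\big[(1+\theta)\langle p\rangle_\Omega^x+(1-\theta)\langle p\rangle_\Omega^y\big]+\sum_{s=1}^4\omega_s\,\overline{p(x^{(s)},y^{(s)})},$$ where the boundary weight is $$\overline\omega_\star=\Big[2|\theta|+\tfrac{20}{3}+\tfrac23\sqrt{126\theta^2+96|\theta|+94}\,\cos\Big(\tfrac13\arccos\tfrac{864|\theta|^3+2916\theta^2+288|\theta|-532}{(126\theta^2+96|\theta|+94)^{3/2}}\Big)\Big]^{-1},$$ and the nodes and weights are as follows. Let $$m_{ij}=\frac1{(i+1)(j+1)}-\overline\omega_\star\Big[\frac{1+\theta}{1+j}+\frac{1-\theta}{1+i}\Big],\qquad i,j\in\{0,2,4,6\},\ i+j\le 6 .$$ Nodes 1 and 2. For $\theta\in[-1,0]$ let $$\beta_1=1-\frac{m_{22}^2}{m_{42}m_{02}}+\frac{\sqrt{30}+2}{36}\theta^2,\quad \beta_2=m_{42}m_{02}-m_{22}^2,\quad \beta_3=m_{06}m_{02}-m_{04}^2,$$ $$x^{(1)}=\sqrt{\tfrac{m_{22}-\sqrt{(1-\beta_1)\beta_2/\beta_1}}{m_{02}}},\quad y^{(1)}=\sqrt{\tfrac{m_{04}+\sqrt{(1-\beta_1)\beta_3/\beta_1}}{m_{02}}},\quad \omega_1=\frac{\beta_1m_{02}}{(y^{(1)})^2},$$ $$x^{(2)}=\sqrt{\tfrac{m_{22}+\sqrt{\beta_1\beta_2/(1-\beta_1)}}{m_{02}}},\quad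 y^{(2)}=\sqrt{\tfrac{m_{04}-\sqrt{\beta_1\beta_3/(1-\beta_1)}}{m_{02}}},\quad \omega_2=\frac{(1-\beta_1)m_{02}}{(y^{(2)})^2}.$$ For $\theta\in[0,1]$ let $$\beta_1=1-\frac{m_{22}^2}{m_{24}m_{20}}+\frac{\sqrt{30}+2}{36}\theta^2,\quad \beta_2=m_{60}m_{20}-m_{40}^2,\quad \beta_3=m_{24}m_{20}-m_{22}^2,$$ $$x^{(1)}=\sqrt{\tfrac{m_{40}+\sqrt{(1-\beta_1)\beta_2/\beta_1}}{m_{20}}},\quad y^{(1)}=\sqrt{\tfrac{m_{22}-\sqrt{(1-\beta_1)\beta_3/\beta_1}}{m_{20}}},\quad \omega_1=\frac{\beta_1m_{20}}{(x^{(1)})^2},$$ $$x^{(2)}=\sqrt{\tfrac{m_{40}-\sqrt{\beta_1\beta_2/(1-\beta_1)}}{m_{20}}},\quad y^{(2)}=\sqrt{\tfrac{m_{22}+\sqrt{\beta_1\beta_3/(1-\beta_1)}}{m_{20}}},\quad \omega_2=\frac{(1-\beta_1)m_{20}}{(x^{(2)})^2}.$$ Nodes 3 and 4. For $r\in\{0,2,4,6\}$ let $m_r=m_{r0}-\omega_1(x^{(1)})^r-\omega_2(x^{(2)})^r$ if $\theta\in[-1,0]$, and $m_r=m_{0r}-\omega_1(y^{(1)})^r-\omega_2(y^{(2)})^r$ if $\theta\in[0,1]$ (with $z^0=1$ for every $z$). Let $$\beta_4=\frac{m_6m_0^2-3m_4m_2m_0+2m_2^3}{(m_4m_0-m_2^2)^{3/2}},\qquad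 \omega_3=\frac{m_0}{2}\Big(1+\frac{\beta_4}{\sqrt{\beta_4^2+4}}\Big),\qquad \omega_4=\frac{m_0}{2}\Big(1-\frac{\beta_4}{\sqrt{\beta_4^2+4}}\Big),$$ $$z_3=\sqrt{\tfrac{m_2}{m_0}-\sqrt{\tfrac{\omega_4}{\omega_3}}\,\tfrac{\sqrt{m_4m_0-m_2^2}}{m_0}},\qquad z_4=\sqrt{\tfrac{m_2}{m_0}+\sqrt{\tfrac{\omega_3}{\omega_4}}\,\tfrac{\sqrt{m_4m_0-m_2^2}}{m_0}} .$$ Then $(x^{(3)},y^{(3)},x^{(4)},y^{(4)})=(z_3,0,z_4,0)$ if $\theta\in[-1,0]$ and $(x^{(3)},y^{(3)},x^{(4)},y^{(4)})=(0,z_3,0,z_4)$ if $\theta\in[0,1]$. Moreover, for all $\theta\in[-1,1]$ and $k\in\{6,7\}$, $\overline\omega_\star(\theta,\mathbb P^k)=\phi^\star(\theta,\mathbb P^k_+)=\phi^\star(\theta,(\mathbb P^3)^2)$, and there exists a critical positive polynomial for $\phi^\star(\theta,\mathbb P^k_+)$ of the form $q_\star^2$ with $q_\star\in\mathbb P^3\setminus\{0\}$.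
   Context: $\mathbb P^k$: real polynomials in $(x,y)$ of total degree at most $k$. $\langle p\rangle_\Omega=\frac14\iint_\Omega p$, $\langle p\rangle_\Omega^x=\frac14\int_{-1}^1[p(-1,y)+p(1,y)]dy$, $\langle p\rangle_\Omega^y=\frac14\int_{-1}^1[p(x,-1)+p(x,1)]dx$, $\overline{p(a,b)}=\frac14[p(a,b)+p(-a,b)+p(a,-b)+p(-a,-b)]$. A feasible symmetric CAD for $(\theta,\mathbb P^k)$ with boundary weight $\overline\omega$ is an identity $\langle p\rangle_\Omega=\overline\omega[(1+\theta)\langle p\rangle_\Omega^x+(1-\theta)\langle p\rangle_\Omega^y]+\sum_{s=1}^S\omega_s\overline{p(x^{(s)},y^{(s)})}$ valid for all $p\in\mathbb P^k$, with $S\ge0$ finite, $\overline\omega>0$, all $\omega_s>0$, all $(x^{(s)},y^{(s)})\in[0,1]^2$. $\overline\omega_\star(\theta,\mathbb P^k)$ is the maximum of $\overline\omega$ over all such CADs, and a symmetric OCAD is one attaining it. $\mathbb P^k_+=\{p\in\mathbb P^k:p\ge0\text{ on }\Omega\}$. For $p\in\mathbb P_+^k$, $\phi(p;\theta)=\dfrac{\langle p\rangle_\Omega}{(1+\theta)\langle p\rangle_\Omega^x+(1-\theta)\langle p\rangle_\Omega^y}$ if the denominator is nonzero, $+\infty$ otherwise; $\phi^\star(\theta,\mathbb P^k_+)=\inf_{p\in\mathbb P^k_+}\phi(p;\theta)$ and $\phi^\star(\theta,(\mathbb P^m)^2)=\inf_{q\in\mathbb P^m}\phi(q^2;\theta)$.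 A critical positive polynomial for $\phi^\star(\theta,\mathbb P^k_+)$ is a $p^\star\in\mathbb P^k_+\setminus\{0\}$ with $\phi(p^\star;\theta)=\phi^\star(\theta,\mathbb P^k_+)$. *)

theory Defs
  imports "HOL-Analysis.Analysis"
begin

text \<open>Real bivariate polynomials are represented by the functions they induce on the plane.
  Over the reals this is faithful, and \<open>bpoly k\<close> is the space of polynomials of total degree
  at most \<open>k\<close>.  The domain is the square \<open>[-1,1]\<^sup>2\<close>.\<close>

definition bpoly :: "nat \<Rightarrow> (real \<Rightarrow> real \<Rightarrow> real) set" where
  "bpoly k = {p. \<exists>c. \<forall>x y. p x y = (\<Sum>i\<le>k. \<Sum>j\<le>k - i. c i j * x ^ i * y ^ j)}"

definition bpoly_nonneg :: "nat \<Rightarrow> (real \<Rightarrow> real \<Rightarrow> real) set" where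
  "bpoly_nonneg k = {p \<in> bpoly k. \<forall>x\<in>{-1..1}. \<forall>y\<in>{-1..1}. 0 \<le> p x y}"

definition bpoly_squares :: "nat \<Rightarrow> (real \<Rightarrow> real \<Rightarrow> real) set" where
  "bpoly_squares m = {\<lambda>x y. (q x y)\<^sup>2 | q. q \<in> bpoly m}"

definition avg :: "(real \<Rightarrow> real \<Rightarrow> real) \<Rightarrow> real" where
  "avg p = 1 / 4 * integral ({-1..1} \<times> {-1..1}) (\<lambda>(x, y). p x y)"

definition avg_x :: "(real \<Rightarrow> real \<Rightarrow> real) \<Rightarrow> real" where
  "avg_x p = 1 / 4 * integral {-1..1} (\<lambda>y. p (-1) y + p 1 y)"

definition avg_y :: "(real \<Rightarrow> real \<Rightarrow> real) \<Rightarrow> real" where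
  "avg_y p = 1 / 4 * integral {-1..1} (\<lambda>x. p x (-1) + p x 1)"

definition bdry_avg :: "real \<Rightarrow> (real \<Rightarrow> real \<Rightarrow> real) \<Rightarrow> real" where
  "bdry_avg \<theta> p = (1 + \<theta>) * avg_x p + (1 - \<theta>) * avg_y p"

definition sym_avg :: "(real \<Rightarrow> real \<Rightarrow> real) \<Rightarrow> real \<Rightarrow> real \<Rightarrow> real" where
  "sym_avg p a b = 1 / 4 * (p a b + p (-a) b + p a (-b) + p (-a) (-b))"

text \<open>The internal part of a CAD is a list of triples \<open>(\<omega>\<^sub>s, x\<^sub>s, y\<^sub>s)\<close>;
  the list may be empty, and repeated nodes are allowed.\<close>

definition feasible_symmetric_CAD ::
  "real \<Rightarrow> nat \<Rightarrow> real \<Rightarrow> (real \<times> real \<times> real) list \<Rightarrow> bool" where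
  "feasible_symmetric_CAD \<theta> k w nodes \<longleftrightarrow>
     w > 0 \<and>
     (\<forall>(\<omega>, x, y) \<in> set nodes. \<omega> > 0 \<and> x \<in> {0..1} \<and> y \<in> {0..1}) \<and>
     (\<forall>p \<in> bpoly k. avg p = w * bdry_avg \<theta> p + (\<Sum>(\<omega>, x, y)\<leftarrow>nodes. \<omega> * sym_avg p x y))"

text \<open>\<open>Greatest\<close> is a maximum, not a supremum: its value is meaningful only if the maximum is
  attained.  The definition of \<open>symmetric_OCAD\<close> therefore spells out attainment
  instead of referring to \<open>max_bdry_weight\<close>.\<close>

definition max_bdry_weight :: "real \<Rightarrow> nat \<Rightarrow> real" where
  "max_bdry_weight \<theta> k = (GREATEST w. \<exists>nodes. feasible_symmetric_CAD \<theta> k w nodes)"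

definition symmetric_OCAD ::
  "real \<Rightarrow> nat \<Rightarrow> real \<Rightarrow> (real \<times> real \<times> real) list \<Rightarrow> bool" where
  "symmetric_OCAD \<theta> k w nodes \<longleftrightarrow>
     feasible_symmetric_CAD \<theta> k w nodes \<and>
     (\<forall>w' nodes'. feasible_symmetric_CAD \<theta> k w' nodes' \<longrightarrow> w' \<le> w)"

definition phi :: "real \<Rightarrow> (real \<Rightarrow> real \<Rightarrow> real) \<Rightarrow> ereal" where
  "phi \<theta> p = (if bdry_avg \<theta> p \<noteq> 0 then ereal (avg p / bdry_avg \<theta> p) else \<infinity>)"

definition phi_star :: "real \<Rightarrow> (real \<Rightarrow> real \<Rightarrow> real) set \<Rightarrow> ereal" where
  "phi_star \<theta> P = (INF p\<in>P. phi \<theta> p)"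

definition critical_positive_poly :: "real \<Rightarrow> nat \<Rightarrow> (real \<Rightarrow> real \<Rightarrow> real) \<Rightarrow> bool" where
  "critical_positive_poly \<theta> k p \<longleftrightarrow>
     p \<in> bpoly_nonneg k \<and> p \<noteq> (\<lambda>x y. 0) \<and> phi \<theta> p = phi_star \<theta> (bpoly_nonneg k)"

definition wbar_rad :: "real \<Rightarrow> real" where
  "wbar_rad \<theta> = 126 * \<theta>\<^sup>2 + 96 * \<bar>\<theta>\<bar> + 94"

definition wbar_arg :: "real \<Rightarrow> real" where
  "wbar_arg \<theta> =
     (864 * \<bar>\<theta>\<bar> ^ 3 + 2916 * \<theta>\<^sup>2 + 288 * \<bar>\<theta>\<bar> - 532) / wbar_rad \<theta> powr (3 / 2)"

definition wbar_inv :: "real \<Rightarrow> real" where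
  "wbar_inv \<theta> =
     2 * \<bar>\<theta>\<bar> + 20 / 3 + 2 / 3 * sqrt (wbar_rad \<theta>) * cos (1 / 3 * arccos (wbar_arg \<theta>))"

definition wbar :: "real \<Rightarrow> real" where
  "wbar \<theta> = inverse (wbar_inv \<theta>)"

definition mom :: "real \<Rightarrow> nat \<Rightarrow> nat \<Rightarrow> real" where
  "mom \<theta> i j = 1 / ((real i + 1) * (real j + 1))
     - wbar \<theta> * ((1 + \<theta>) / (1 + real j) + (1 - \<theta>) / (1 + real i))"

text \<open>Nodes 1 and 2.  The suffix \<open>N\<close> marks the formulas for \<open>\<theta> \<in> [-1,0]\<close>, the suffix \<open>P\<close>
  those for \<open>\<theta> \<in> [0,1]\<close>.  The constants \<open>X1N\<close>, \<open>Y1N\<close>, etc. are the radicands of the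
  outer square roots, that is, the squares of the coordinates.\<close>

definition "beta1N \<theta> =
  1 - (mom \<theta> 2 2)\<^sup>2 / (mom \<theta> 4 2 * mom \<theta> 0 2) + (sqrt 30 + 2) / 36 * \<theta>\<^sup>2"
definition "beta2N \<theta> = mom \<theta> 4 2 * mom \<theta> 0 2 - (mom \<theta> 2 2)\<^sup>2"
definition "beta3N \<theta> = mom \<theta> 0 6 * mom \<theta> 0 2 - (mom \<theta> 0 4)\<^sup>2"

definition "X1N \<theta> =
  (mom \<theta> 2 2 - sqrt ((1 - beta1N \<theta>) * beta2N \<theta> / beta1N \<theta>)) / mom \<theta> 0 2"
definition "Y1N \<theta> =
  (mom \<theta> 0 4 + sqrt ((1 - beta1N \<theta>) * beta3N \<theta> / beta1N \<theta>)) / mom \<theta> 0 2"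
definition "X2N \<theta> =
  (mom \<theta> 2 2 + sqrt (beta1N \<theta> * beta2N \<theta> / (1 - beta1N \<theta>))) / mom \<theta> 0 2"
definition "Y2N \<theta> =
  (mom \<theta> 0 4 - sqrt (beta1N \<theta> * beta3N \<theta> / (1 - beta1N \<theta>))) / mom \<theta> 0 2"

definition "x1N \<theta> = sqrt (X1N \<theta>)"
definition "y1N \<theta> = sqrt (Y1N \<theta>)"
definition "x2N \<theta> = sqrt (X2N \<theta>)"
definition "y2N \<theta> = sqrt (Y2N \<theta>)"
definition "omega1N \<theta> = beta1N \<theta> * mom \<theta> 0 2 / (y1N \<theta>)\<^sup>2"
definition "omega2N \<theta> = (1 - beta1N \<theta>) * mom \<theta> 0 2 / (y2N \<theta>)\<^sup>2"

definition "beta1P \<theta> =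
  1 - (mom \<theta> 2 2)\<^sup>2 / (mom \<theta> 2 4 * mom \<theta> 2 0) + (sqrt 30 + 2) / 36 * \<theta>\<^sup>2"
definition "beta2P \<theta> = mom \<theta> 6 0 * mom \<theta> 2 0 - (mom \<theta> 4 0)\<^sup>2"
definition "beta3P \<theta> = mom \<theta> 2 4 * mom \<theta> 2 0 - (mom \<theta> 2 2)\<^sup>2"

definition "X1P \<theta> =
  (mom \<theta> 4 0 + sqrt ((1 - beta1P \<theta>) * beta2P \<theta> / beta1P \<theta>)) / mom \<theta> 2 0"
definition "Y1P \<theta> =
  (mom \<theta> 2 2 - sqrt ((1 - beta1P \<theta>) * beta3P \<theta> / beta1P \<theta>)) / mom \<theta> 2 0"
definition "X2P \<theta> =
  (mom \<theta> 4 0 - sqrt (beta1P \<theta> * beta2P \<theta> / (1 - beta1P \<theta>))) / mom \<theta> 2 0"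
definition "Y2P \<theta> =
  (mom \<theta> 2 2 + sqrt (beta1P \<theta> * beta3P \<theta> / (1 - beta1P \<theta>))) / mom \<theta> 2 0"

definition "x1P \<theta> = sqrt (X1P \<theta>)"
definition "y1P \<theta> = sqrt (Y1P \<theta>)"
definition "x2P \<theta> = sqrt (X2P \<theta>)"
definition "y2P \<theta> = sqrt (Y2P \<theta>)"
definition "omega1P \<theta> = beta1P \<theta> * mom \<theta> 2 0 / (x1P \<theta>)\<^sup>2"
definition "omega2P \<theta> = (1 - beta1P \<theta>) * mom \<theta> 2 0 / (x2P \<theta>)\<^sup>2"

text \<open>Nodes 3 and 4, on the axis \<open>y = 0\<close> (suffix \<open>N\<close>) or \<open>x = 0\<close> (suffix \<open>P\<close>), in terms
  of the one-dimensional moments \<open>m r\<close>, \<open>r \<in> {0,2,4,6}\<close>, left over by nodes 1 and 2.\<close>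

definition "resN \<theta> r = mom \<theta> r 0 - omega1N \<theta> * x1N \<theta> ^ r - omega2N \<theta> * x2N \<theta> ^ r"
definition "resP \<theta> r = mom \<theta> 0 r - omega1P \<theta> * y1P \<theta> ^ r - omega2P \<theta> * y2P \<theta> ^ r"

definition beta4 :: "(nat \<Rightarrow> real) \<Rightarrow> real" where
  "beta4 m = (m 6 * (m 0)\<^sup>2 - 3 * m 4 * m 2 * m 0 + 2 * m 2 ^ 3)
     / (m 4 * m 0 - (m 2)\<^sup>2) powr (3 / 2)"
definition omega3 :: "(nat \<Rightarrow> real) \<Rightarrow> real" where
  "omega3 m = m 0 / 2 * (1 + beta4 m / sqrt ((beta4 m)\<^sup>2 + 4))"
definition omega4 :: "(nat \<Rightarrow> real) \<Rightarrow> real" where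
  "omega4 m = m 0 / 2 * (1 - beta4 m / sqrt ((beta4 m)\<^sup>2 + 4))"
definition Z3 :: "(nat \<Rightarrow> real) \<Rightarrow> real" where
  "Z3 m = m 2 / m 0 - sqrt (omega4 m / omega3 m) * (sqrt (m 4 * m 0 - (m 2)\<^sup>2) / m 0)"
definition Z4 :: "(nat \<Rightarrow> real) \<Rightarrow> real" where
  "Z4 m = m 2 / m 0 + sqrt (omega3 m / omega4 m) * (sqrt (m 4 * m 0 - (m 2)\<^sup>2) / m 0)"
definition z3 :: "(nat \<Rightarrow> real) \<Rightarrow> real" where "z3 m = sqrt (Z3 m)"
definition z4 :: "(nat \<Rightarrow> real) \<Rightarrow> real" where "z4 m = sqrt (Z4 m)"

definition nodesN :: "real \<Rightarrow> (real \<times> real \<times> real) list" where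
  "nodesN \<theta> =
     [(omega1N \<theta>, x1N \<theta>, y1N \<theta>),
      (omega2N \<theta>, x2N \<theta>, y2N \<theta>),
      (omega3 (resN \<theta>), z3 (resN \<theta>), 0),
      (omega4 (resN \<theta>), z4 (resN \<theta>), 0)]"

definition nodesP :: "real \<Rightarrow> (real \<times> real \<times> real) list" where
  "nodesP \<theta> =
     [(omega1P \<theta>, x1P \<theta>, y1P \<theta>),
      (omega2P \<theta>, x2P \<theta>, y2P \<theta>),
      (omega3 (resP \<theta>), 0, z3 (resP \<theta>)),
      (omega4 (resP \<theta>), 0, z4 (resP \<theta>))]"

text \<open>Division, \<open>sqrt\<close>, \<open>powr\<close> and \<open>arccos\<close> are total functions in HOL.  The following
  predicates say that all the formulas above are meaningful as real expressions: no division
  by zero, no square root of a negative number, and the argument of \<open>arccos\<close> in \<open>[-1,1]\<close>.\<close>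

definition wbar_defined :: "real \<Rightarrow> bool" where
  "wbar_defined \<theta> \<longleftrightarrow>
     wbar_rad \<theta> > 0 \<and> wbar_arg \<theta> \<in> {-1..1} \<and> wbar_inv \<theta> \<noteq> 0"

definition nodes12N_defined :: "real \<Rightarrow> bool" where
  "nodes12N_defined \<theta> \<longleftrightarrow>
     mom \<theta> 4 2 \<noteq> 0 \<and> mom \<theta> 0 2 \<noteq> 0 \<and> beta1N \<theta> \<noteq> 0 \<and> beta1N \<theta> \<noteq> 1 \<and>
     (1 - beta1N \<theta>) * beta2N \<theta> / beta1N \<theta> \<ge> 0 \<and>
     (1 - beta1N \<theta>) * beta3N \<theta> / beta1N \<theta> \<ge> 0 \<and>
     beta1N \<theta> * beta2N \<theta> / (1 - beta1N \<theta>) \<ge> 0 \<and>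
     beta1N \<theta> * beta3N \<theta> / (1 - beta1N \<theta>) \<ge> 0 \<and>
     X1N \<theta> \<ge> 0 \<and> Y1N \<theta> > 0 \<and> X2N \<theta> \<ge> 0 \<and> Y2N \<theta> > 0"

definition nodes12P_defined :: "real \<Rightarrow> bool" where
  "nodes12P_defined \<theta> \<longleftrightarrow>
     mom \<theta> 2 4 \<noteq> 0 \<and> mom \<theta> 2 0 \<noteq> 0 \<and> beta1P \<theta> \<noteq> 0 \<and> beta1P \<theta> \<noteq> 1 \<and>
     (1 - beta1P \<theta>) * beta2P \<theta> / beta1P \<theta> \<ge> 0 \<and>
     (1 - beta1P \<theta>) * beta3P \<theta> / beta1P \<theta> \<ge> 0 \<and>
     beta1P \<theta> * beta2P \<theta> / (1 - beta1P \<theta>) \<ge> 0 \<and>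
     beta1P \<theta> * beta3P \<theta> / (1 - beta1P \<theta>) \<ge> 0 \<and>
     X1P \<theta> > 0 \<and> Y1P \<theta> \<ge> 0 \<and> X2P \<theta> > 0 \<and> Y2P \<theta> \<ge> 0"

definition nodes34_defined :: "(nat \<Rightarrow> real) \<Rightarrow> bool" where
  "nodes34_defined m \<longleftrightarrow>
     m 0 \<noteq> 0 \<and> m 4 * m 0 - (m 2)\<^sup>2 > 0 \<and> omega3 m \<noteq> 0 \<and> omega4 m \<noteq> 0 \<and>
     omega4 m / omega3 m \<ge> 0 \<and> omega3 m / omega4 m \<ge> 0 \<and> Z3 m \<ge> 0 \<and> Z4 m \<ge> 0"

end

theory Submission
  imports Defs
begin

text \<open>By the symmetry exchanging \<open>x\<close> and \<open>y\<close> we may take \<open>\<theta> = -t\<close> with \<open>t \<in> [0,1]\<close>. The number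
  \<open>wbar \<theta>\<close> is the boundary weight at which the moment matrix of \<open>y, x\<^sup>2 y, y\<^sup>3\<close> becomes singular.
  Its kernel polynomial \<open>q = y (G - K x\<^sup>2 - B y\<^sup>2)\<close> is the critical one: nodes 1 and 2 lie on the
  conic \<open>q / y = 0\<close>, nodes 3 and 4 on \<open>y = 0\<close>, so applying the identity to \<open>q\<^sup>2\<close> shows that no larger
  boundary weight is possible.

  The moments divisible by \<open>y\<^sup>2\<close> form a singular matrix of rank two and are represented by a
  one-parameter family of two-atom measures in \<open>(x\<^sup>2, y\<^sup>2)\<close>; \<open>beta\<close> selects one of them. The remaining
  moments in \<open>x\<^sup>2\<close> are matched by the two-point Gauss quadrature of nodes 3 and 4, whose nodes lie in
  \<open>[0,1]\<close> iff two Hankel determinants are nonnegative. After the substitution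
  \<open>1 / wbar \<theta> = 11 + 9 t + h\<close> with \<open>0 \<le> h \<le> (1 - t)\<^sup>2 / 2\<close>, all sign conditions reduce to polynomial
  inequalities in \<open>t\<close> and \<open>h\<close>. The only tight one is the first Hankel determinant at \<open>t = 0\<close>: it is a
  difference of the moment determinants for \<open>y, x\<^sup>2 y, y\<^sup>3\<close> and for \<open>x, x\<^sup>3, x y\<^sup>2\<close>, which is
  divisible by \<open>t\<close>.\<close>

subsection \<open>The boundary weight\<close>

text \<open>Viete's substitution: for z = 2/3 sqrt R cos p the cubic equation becomes the triple
  angle formula for cos (3 p). Since p lies in [0, pi/3], cos p is at least 1/2, so z is at or
  beyond the larger critical point sqrt R / 3 of the cubic, which makes it the largest root.\<close>

lemma trig_cubic_root:
  fixes R A :: real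
  assumes "R > 0" and "A\<^sup>2 \<le> R ^ 3"
  defines "z \<equiv> 2 / 3 * sqrt R * cos (1 / 3 * arccos (A / R powr (3 / 2)))"
  shows "A / R powr (3 / 2) \<in> {-1..1}" and "27 * z ^ 3 - 9 * R * z = 2 * A" and "sqrt R \<le> 3 * z"
proof -
  define x where "x = A / R powr (3 / 2)"
  have R32: "R powr (3 / 2) = sqrt R ^ 3"
    using assms(1) by (simp add: powr_half_sqrt[symmetric] powr_powr flip: powr_realpow)
  define q where "q = sqrt R"
  have q: "q > 0" "R = q\<^sup>2"
    using assms(1) by (auto simp: q_def)
  have "(q ^ 3)\<^sup>2 = R ^ 3"
    unfolding q(2) by algebra
  then have "\<bar>A\<bar>\<^sup>2 \<le> (q ^ 3)\<^sup>2"
    using assms(2) by simp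
  then have "\<bar>A\<bar> \<le> q ^ 3"
    by (rule power2_le_imp_le) (use q in simp)
  define x where "x = A / q ^ 3"
  have Rx: "A / R powr (3 / 2) = x" and A: "A = x * q ^ 3"
    using q(1) by (simp_all add: x_def R32 flip: q_def)
  have x: "-1 \<le> x" "x \<le> 1"
    using \<open>\<bar>A\<bar> \<le> q ^ 3\<close> q(1) by (simp_all add: x_def field_simps abs_le_iff)
  then show "A / R powr (3 / 2) \<in> {-1..1}"
    by (simp add: Rx)
  define p where "p = 1 / 3 * arccos x"
  have p: "0 \<le> p" "p \<le> pi / 3"
    using x arccos_lbound[of x] arccos_ubound[of x] by (auto simp: p_def)
  have "cos (3 * p) = x"
    using x by (simp add: p_def)
  then have c: "x = 4 * cos p ^ 3 - 3 * cos p"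
    by (simp add: cos_treble_cos)
  have z: "z = 2 / 3 * q * cos p"
    by (simp add: z_def p_def Rx q_def)
  show "27 * z ^ 3 - 9 * R * z = 2 * A"
    unfolding A c z q(2) by algebra
  have "cos (pi / 3) \<le> cos p"
    using p by (intro cos_monotone_0_pi_le) auto
  then show "sqrt R \<le> 3 * z"
    using q(1) mult_left_mono[of "1 / 2" "cos p" "2 * q"] by (simp add: z cos_60 flip: q_def)
qed

text \<open>The cubic solved by \<open>wbar_inv\<close> is a quotient of the quartic below; its largest root is
  written as \<open>11 + 9 * t + h\<close>, where \<open>h\<close> vanishes at \<open>t = 1\<close>.\<close>

lemma wbar_shift:
  fixes \<theta> :: real
  assumes "\<bar>\<theta>\<bar> \<le> 1"
  defines "t \<equiv> \<bar>\<theta>\<bar>"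
  defines "h \<equiv> wbar_inv \<theta> - 11 - 9 * t"
  shows "wbar_defined \<theta>" and "0 \<le> h" and "h \<le> (1 - t)\<^sup>2 / 2"
    and "(2 + 12 * t + h) * (8 + 6 * t + h) * h * (10 + 10 * t + h) = 105 * (1 - t\<^sup>2)\<^sup>2"
proof -
  define R A where "R = 126 * t\<^sup>2 + 96 * t + 94" and "A = 864 * t ^ 3 + 2916 * t\<^sup>2 + 288 * t - 532"
  define z where "z = 2 / 3 * sqrt R * cos (1 / 3 * arccos (A / R powr (3 / 2)))"
  have t: "0 \<le> t" "t \<le> 1"
    using assms(1) by (auto simp: t_def)
  have R: "R > 0"
    using t by (simp add: R_def add_nonneg_pos)
  \<comment> \<open>Expansion in the Bernstein basis t^i (1-t)^(6-i). Its coefficients are positive,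
    so the argument of arccos is admissible on all of [0,1].\<close>
  have "R ^ 3 - A\<^sup>2 = 547560 * (1 - t) ^ 6 + 6136560 * (t * (1 - t) ^ 5) + 31428000 * (t ^ 2 * (1 - t) ^ 4)
      + 82244160 * (t ^ 3 * (1 - t) ^ 3) + 110276640 * (t ^ 4 * (1 - t) ^ 2)
      + 71668800 * (t ^ 5 * (1 - t)) + 19051200 * t ^ 6"
    unfolding R_def A_def by algebra
  also have "\<dots> \<ge> 0"
    using t by (intro add_nonneg_nonneg mult_nonneg_nonneg zero_le_power) auto
  finally have AR: "A\<^sup>2 \<le> R ^ 3" by simp
  have rad: "wbar_rad \<theta> = R" and arg: "wbar_arg \<theta> = A / R powr (3 / 2)"
    by (simp_all add: wbar_rad_def wbar_arg_def R_def A_def t_def)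
  have z: "wbar_inv \<theta> = 2 * t + 20 / 3 + z" "z = h + 13 / 3 + 7 * t"
    by (simp_all add: wbar_inv_def rad arg z_def h_def t_def)
  note root = trig_cubic_root[OF R AR, folded z_def]
  have z0: "sqrt R \<le> 3 * z" "0 \<le> z" "R \<le> 9 * z\<^sup>2"
  proof -
    show *: "sqrt R \<le> 3 * z" by (rule root)
    then show "0 \<le> z"
      using R real_sqrt_ge_zero[of R] by linarith
    show "R \<le> 9 * z\<^sup>2"
      using power_mono[OF *, of 2] R by (simp add: power_mult_distrib)
  qed
  \<comment> \<open>The extra factor 7 + 7 * t + h is \<open>n02 / 105\<close> below. Up to scaling
    the cubic is the determinant of the moment matrix of y, x^2 y, y^3; multiplying by the corner
    entry of that matrix turns it into a difference of two products, see
    \<open>rank\<close>.\<close>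
  have quartic_z: "(7 + 7 * t + h) * (27 * z ^ 3 - 9 * R * z - 2 * A)
      = 27 * ((2 + 12 * t + h) * (8 + 6 * t + h) * h * (10 + 10 * t + h) - 105 * (1 - t\<^sup>2)\<^sup>2)"
    unfolding z(2) R_def A_def by algebra
  then show quartic: "(2 + 12 * t + h) * (8 + 6 * t + h) * h * (10 + 10 * t + h) = 105 * (1 - t\<^sup>2)\<^sup>2"
    using root(2) by (simp add: ac_simps)
  show h: "0 \<le> h"
  proof (rule ccontr)
    assume "\<not> 0 \<le> h"
    \<comment> \<open>The value of z at h = 0. The cubic is at most 0 there and equals 0 at z, but
      it increases strictly beyond its larger critical point, so z < y is impossible.\<close>
    define y where "y = 13 / 3 + 7 * t"
    have y: "z < y" "0 < y"
      using \<open>\<not> 0 \<le> h\<close> t by (auto simp: z(2) y_def)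
    have "27 * y ^ 3 - 9 * R * y - 2 * A = - (405 * (1 - t)\<^sup>2 * (1 + t))"
      unfolding y_def R_def A_def by algebra
    also have "\<dots> \<le> 0"
      using t by simp
    finally have "27 * y ^ 3 - 9 * R * y \<le> 27 * z ^ 3 - 9 * R * z"
      using root(2) by simp
    then have "(y - z) * (27 * (y\<^sup>2 + y * z + z\<^sup>2) - 9 * R) \<le> 0"
      by (simp add: algebra_simps power2_eq_square power3_eq_cube)
    moreover have "y\<^sup>2 > z\<^sup>2" "y * z \<ge> z\<^sup>2"
      using y z0 by (auto simp: power2_eq_square intro: mult_strict_mono mult_right_mono)
    ultimately show False
      using y z0(3) by (auto simp: mult_le_0_iff)
  qed
  show "h \<le> (1 - t)\<^sup>2 / 2"
  proof (rule ccontr)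
    \<comment> \<open>The left side of the quartic increases with h, so it suffices that at h = g it
      already reaches the right side. As g contains the factor (1-t)^2, this factor cancels from the
      comparison.\<close>
    define g where "g = (1 - t)\<^sup>2 / 2"
    assume "\<not> h \<le> (1 - t)\<^sup>2 / 2"
    then have g: "0 \<le> g" "g < h"
      by (auto simp: g_def)
    have "105 * (1 + t)\<^sup>2 \<le> (2 + 12 * t + g) * (8 + 6 * t + g) * (10 + 10 * t + g) / 2"
    proof -
      have "(2 + 12 * t + g) * (8 + 6 * t + g) * (10 + 10 * t + g) / 2 - 105 * (1 + t)\<^sup>2
        = 105 / 16 + 3537 / 8 * t + 11119 / 16 * t ^ 2 + 1363 / 4 * t ^ 3 + 839 / 16 * t ^ 4 + 25 / 8 * t ^ 5 + 1 / 16 * t ^ 6"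
        by (simp add: g_def field_simps eval_nat_numeral)
      also have "\<dots> \<ge> 0"
        using t by simp
      finally show ?thesis by simp
    qed
    then have "105 * (1 + t)\<^sup>2 * (1 - t)\<^sup>2
        \<le> (2 + 12 * t + g) * (8 + 6 * t + g) * (10 + 10 * t + g) / 2 * (1 - t)\<^sup>2"
      by (rule mult_right_mono) simp
    also have "\<dots> = (2 + 12 * t + g) * (8 + 6 * t + g) * g * (10 + 10 * t + g)"
      by (simp add: g_def)
    also have "\<dots> < (2 + 12 * t + h) * (8 + 6 * t + h) * h * (10 + 10 * t + h)"
      using g t by (intro mult_strict_mono mult_nonneg_nonneg) (auto intro: mult_nonneg_nonneg add_pos_nonneg)
    also have "\<dots> = 105 * (1 + t)\<^sup>2 * (1 - t)\<^sup>2"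
      unfolding quartic by (simp add: power2_eq_square algebra_simps)
    finally show False by simp
  qed
  show "wbar_defined \<theta>"
    unfolding wbar_defined_def rad arg z(1) using R root(1) z0(2) t by auto
qed

subsection \<open>Normalised moments\<close>

locale quartic_root =
  fixes t h :: real
  assumes t: "0 \<le> t" "t \<le> 1"
    and h: "0 \<le> h" "h \<le> (1 - t)\<^sup>2 / 2"
    and quartic: "(2 + 12 * t + h) * (8 + 6 * t + h) * h * (10 + 10 * t + h) = 105 * (1 - t\<^sup>2)\<^sup>2"
begin

text \<open>\<open>nij\<close> is \<open>315 * mom \<theta> i j / wbar \<theta>\<close> for \<open>\<theta> = -t\<close> and \<open>wbar_inv \<theta> = 11 + 9 * t + h\<close>.\<close>

definition "n00 = 315 * (9 + 9 * t + h)"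
definition "n20 = 105 * (7 + 11 * t + h)"
definition "n40 = 63 * (5 + 13 * t + h)"
definition "n60 = 45 * (3 + 15 * t + h)"
definition "n02 = 105 * (7 + 7 * t + h)"
definition "n22 = 35 * (5 + 9 * t + h)"
definition "n42 = 21 * (3 + 11 * t + h)"
definition "n04 = 63 * (5 + 5 * t + h)"
definition "n24 = 21 * (3 + 7 * t + h)"
definition "n06 = 45 * (3 + 3 * t + h)"

lemmas n_defs = n00_def n20_def n40_def n60_def n02_def n22_def n42_def n04_def n24_def n06_def

text \<open>Up to sign, the 2x2 minors of the first two rows of the moment matrix of y, x^2 y, y^3.
  The cross product (-G, K, B) of these rows spans the kernel once the determinant vanishes.\<close>

definition "B = n02 * n42 - n22\<^sup>2"
definition "K = n22 * n04 - n24 * n02"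
definition "G = n04 * n42 - n24 * n22"

lemma B_eq: "B = 980 * ((2 + 12 * t + h) * (8 + 6 * t + h))"
  and K_eq: "K = 8820 * (1 - t\<^sup>2)"
  and G_eq: "G = 588 * (15 + 80 * t + 45 * t\<^sup>2 + (8 + 16 * t) * h + h\<^sup>2)"
  and B3_eq: "n02 * n06 - n04\<^sup>2 = 756 * (h * (10 + 10 * t + h))"
  unfolding B_def K_def G_def n_defs by algebra+

lemma n_pos: "n02 > 0" "n22 > 0" "n42 > 0" "n04 > 0" "n24 > 0"
  and BG_pos: "B > 0" "G > 0" and K_nonneg: "K \<ge> 0"
  using t h by (auto simp: n_defs B_eq G_eq K_eq abs_le_iff power_le_one intro!: add_pos_nonneg mult_pos_pos)

text \<open>The quartic in terms of moments. The difference of the two sides is, up to sign,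
  \<open>n02\<close> times the determinant of the moment matrix of y, x^2 y, y^3, so the equation
  says that this matrix is singular.\<close>

lemma rank: "K\<^sup>2 = B * (n02 * n06 - n04\<^sup>2)"
proof -
  have "B * (n02 * n06 - n04\<^sup>2)
      = 740880 * ((2 + 12 * t + h) * (8 + 6 * t + h) * h * (10 + 10 * t + h))"
    by (simp add: B_eq B3_eq)
  then show ?thesis
    unfolding quartic K_eq by algebra
qed

lemma h_half: "0 \<le> 1 - 2 * h"
  using h t power_le_one[of "1 - t" 2] by simp

text \<open>The following polynomial inequalities are certified by expansions with nonnegative coefficients
  in \<open>t\<close>, \<open>1 - t\<close>, \<open>h\<close> and \<open>1 - 2 * h\<close>.\<close>

lemma beta_bound: "2078 * (t ^ 2 * n02 * n42) + 1 \<le> 10000 * n22 ^ 2"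
proof -
  have "10000 * n22 ^ 2 - (2078 * (t ^ 2 * n02 * n42) + 1)
      = 12250000 * ((1 - t) ^ 2 * h ^ 2) + 24500000 * (t * (1 - t) * h ^ 2) +
        7668010 * (t ^ 2 * h ^ 2) + 122500000 * ((1 - t) ^ 3 * h) +
        588000000 * (t * (1 - t) ^ 2 * h) + 762680100 * (t ^ 2 * (1 - t) * h) +
        214704280 * (t ^ 3 * h) + 306249999 * (1 - t) ^ 4 + 2327499996 * (t * (1 - t) ^ 3) +
        6041028204 * (t ^ 2 * (1 - t) ^ 2) + 5875521396 * (t ^ 3 * (1 - t)) + 1502929959 * t ^ 4"
    unfolding n_defs by algebra
  also have "\<dots> \<ge> 0"
    using t h h_half by (intro add_nonneg_nonneg mult_nonneg_nonneg zero_le_power) auto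
  finally show ?thesis by simp
qed

text \<open>Keeps the trial point t^2 / 8 at or to the left of the vertex n22 / n02 of the parabola
  in \<open>X1_equation\<close>.\<close>

lemma X1_hi_mean: "t ^ 2 * n02 \<le> 8 * n22"
proof -
  have "8 * n22 - (t ^ 2 * n02)
      = 280 * ((1 - t) ^ 2 * h) + 560 * (t * (1 - t) * h) + 175 * (t ^ 2 * h) +
        1400 * (1 - t) ^ 3 + 6720 * (t * (1 - t) ^ 2) + 8505 * (t ^ 2 * (1 - t)) + 2450 * t ^ 3"
    unfolding n_defs by algebra
  also have "\<dots> \<ge> 0"
    using t h h_half by (intro add_nonneg_nonneg mult_nonneg_nonneg zero_le_power) auto
  finally show ?thesis by simp
qed

text \<open>This is \<open>X1_equation\<close> tested at t^2 / 8, with t^2 cancelled and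
  \<open>excess\<close> replaced by its lower bound (2077) on the left and its upper bound (2078) on
  the right of that equation. \<open>X1_lo_bound\<close> is the opposite test at t^2 / 10.\<close>

lemma X1_hi_bound: "64 * 2078 * (n02 * n42 ^ 2) \<le> (16 * n22 - t ^ 2 * n02) * (10000 * B + 2077 * (t ^ 2 * n02 * n42))"
proof -
  have "(16 * n22 - t ^ 2 * n02) * (10000 * B + 2077 * (t ^ 2 * n02 * n42)) - (64 * 2078 * (n02 * n42 ^ 2))
      = 335097280 * ((1 - t) ^ 4 * h ^ 2 * (1 - 2 * h)) +
        1340389120 * (t * (1 - t) ^ 3 * h ^ 2 * (1 - 2 * h)) +
        1242743880 * (t ^ 2 * (1 - t) ^ 2 * h ^ 2 * (1 - 2 * h)) +
        390580960 * (t ^ 3 * (1 - t) * h ^ 3) + 384607615 * (t ^ 4 * h ^ 3) +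
        10384887520 * (t * (1 - t) ^ 4 * h * (1 - 2 * h)) +
        40308900380 * (t ^ 2 * (1 - t) ^ 3 * h * (1 - 2 * h)) +
        27312479460 * (t ^ 3 * (1 - t) ^ 2 * h * (1 - 2 * h)) +
        1928373440 * ((1 - t) ^ 5 * h ^ 2) + 31470148815 * (t ^ 4 * (1 - t) * h ^ 2) +
        16153519830 * (t ^ 5 * h ^ 2) + 148268829520 * (t ^ 3 * (1 - t) ^ 3 * (1 - 2 * h)) +
        48140077440 * ((1 - t) ^ 6 * h) + 245552602400 * (t * (1 - t) ^ 5 * h) +
        191179247700 * (t ^ 2 * (1 - t) ^ 4 * h) + 37430785665 * (t ^ 4 * (1 - t) ^ 2 * h) +
        651502562340 * (t ^ 5 * (1 - t) * h) + 226149277620 * (t ^ 6 * h) +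
        51073742720 * (1 - t) ^ 7 + 878256055040 * (t * (1 - t) ^ 6) +
        3599970412080 * (t ^ 2 * (1 - t) ^ 5) + 5653802056560 * (t ^ 3 * (1 - t) ^ 4) +
        4720070771325 * (t ^ 4 * (1 - t) ^ 3) + 4549141446150 * (t ^ 5 * (1 - t) ^ 2) +
        4024640859260 * (t ^ 6 * (1 - t)) + 1055363295560 * t ^ 7"
    unfolding B_def n_defs by algebra
  also have "\<dots> \<ge> 0"
    using t h h_half by (intro add_nonneg_nonneg mult_nonneg_nonneg zero_le_power) auto
  finally show ?thesis by simp
qed

lemma X1_lo_bound: "(20 * n22 - t ^ 2 * n02) * (10000 * B + 2078 * (t ^ 2 * n02 * n42)) \<le> 100 * 2077 * (n02 * n42 ^ 2)"
proof -
  have "100 * 2077 * (n02 * n42 ^ 2) - ((20 * n22 - t ^ 2 * n02) * (10000 * B + 2078 * (t ^ 2 * n02 * n42)))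
      = 2757548500 * ((1 - t) ^ 4 * h ^ 3) + 11030194000 * (t * (1 - t) ^ 3 * h ^ 3) +
        14366898000 * (t ^ 2 * (1 - t) ^ 2 * h ^ 3) + 6673408000 * (t ^ 3 * (1 - t) * h ^ 3) +
        1060264450 * (t ^ 4 * h ^ 3) + 22128130500 * ((1 - t) ^ 5 * h ^ 2) +
        204329559000 * (t * (1 - t) ^ 4 * h ^ 2) + 565419036000 * (t ^ 2 * (1 - t) ^ 3 * h ^ 2) +
        630686448000 * (t ^ 3 * (1 - t) ^ 2 * h ^ 2) + 279972223650 * (t ^ 4 * (1 - t) * h ^ 2) +
        44531106900 * (t ^ 5 * h ^ 2) + 37734973500 * ((1 - t) ^ 6 * h) +
        770527548000 * (t * (1 - t) ^ 5 * h) + 4186968072000 * (t ^ 2 * (1 - t) ^ 4 * h) +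
        9218457024000 * (t ^ 3 * (1 - t) ^ 3 * h) + 9153769504950 * (t ^ 4 * (1 - t) ^ 2 * h) +
        3915258358200 * (t ^ 5 * (1 - t) * h) + 623435496600 * (t ^ 6 * h) +
        57105555500 * (1 - t) ^ 7 + 756711851000 * (t * (1 - t) ^ 6) +
        6571377162000 * (t ^ 2 * (1 - t) ^ 5) + 25921038220000 * (t ^ 3 * (1 - t) ^ 4) +
        48409419922150 * (t ^ 4 * (1 - t) ^ 3) + 43960997373300 * (t ^ 5 * (1 - t) ^ 2) +
        18250892731400 * (t ^ 6 * (1 - t)) + 2909365650800 * t ^ 7"
    unfolding B_def n_defs by algebra
  also have "\<dots> \<ge> 0"
    using t h h_half by (intro add_nonneg_nonneg mult_nonneg_nonneg zero_le_power) auto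
  finally show ?thesis by simp
qed

lemma X1_hi_n24: "n04 * t ^ 2 + 1 \<le> 8 * n24"
proof -
  have "8 * n24 - (n04 * t ^ 2 + 1)
      = 168 * ((1 - t) ^ 2 * h) + 336 * (t * (1 - t) * h) + 105 * (t ^ 2 * h) + 503 * (1 - t) ^ 3 +
        2685 * (t * (1 - t) ^ 2) + 3546 * (t ^ 2 * (1 - t)) + 1049 * t ^ 3"
    unfolding n_defs by algebra
  also have "\<dots> \<ge> 0"
    using t h h_half by (intro add_nonneg_nonneg mult_nonneg_nonneg zero_le_power) auto
  finally show ?thesis by simp
qed

text \<open>The constant 18424 / 25 is 8 * 94 * 49 / 50: together with G / u \<le> 50 / 49 and X1
  \<le> t^2 / 8 it yields \<delta> \<le> 94 t^2.\<close>

lemma delta_hi_bound: "25 * G * (8 * n42 - n22 * t ^ 2) \<le> 18424 * n24 * (8 * n24 - n04 * t ^ 2)"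
proof -
  have "2 * (18424 * n24 * (8 * n24 - n04 * t ^ 2) - (25 * G * (8 * n42 - n22 * t ^ 2)))
      = 2469600 * ((1 - t) ^ 2 * h ^ 2 * (1 - 2 * h)) +
        4939200 * (t * (1 - t) * h ^ 2 * (1 - 2 * h)) + 1955100 * (t ^ 2 * h ^ 2 * (1 - 2 * h)) +
        40989186 * (t ^ 2 * (1 - t) * h * (1 - 2 * h)) + 34646430 * (t ^ 3 * h * (1 - 2 * h)) +
        73198944 * ((1 - t) ^ 3 * h ^ 2) + 86238432 * (t * (1 - t) ^ 2 * h ^ 2) +
        135452415 * (t ^ 4 * (1 - 2 * h)) + 587369664 * ((1 - t) ^ 4 * h) +
        3102607872 * (t * (1 - t) ^ 3 * h) + 4317649014 * (t ^ 2 * (1 - t) ^ 2 * h) +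
        1337024976 * (t ^ 3 * (1 - t) * h) + 947733696 * (1 - t) ^ 5 +
        8198281728 * (t * (1 - t) ^ 4) + 24018415848 * (t ^ 2 * (1 - t) ^ 3) +
        28011009936 * (t ^ 3 * (1 - t) ^ 2) + 11151936705 * (t ^ 4 * (1 - t)) + 325539585 * t ^ 5"
    unfolding G_def n_defs by algebra
  also have "\<dots> \<ge> 0"
    using t h h_half by (intro add_nonneg_nonneg mult_nonneg_nonneg zero_le_power) auto
  finally show ?thesis by simp
qed

text \<open>The counterpart at the trial point t^2 / 10, where G / u is bounded below by 1.\<close>

lemma delta_lo_bound: "10 * (12 + 47 * t) * n24 * (10 * n24 - n04 * t ^ 2) \<le> G * (10 * n42 - n22 * t ^ 2)"
proof -
  have "G * (10 * n42 - n22 * t ^ 2) - (10 * (12 + 47 * t) * n24 * (10 * n24 - n04 * t ^ 2))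
      = 123480 * ((1 - t) ^ 2 * h ^ 3) + 246960 * (t * (1 - t) * h ^ 3) +
        102900 * (t ^ 2 * h ^ 3) + 829080 * ((1 - t) ^ 3 * h ^ 2) +
        3748500 * (t * (1 - t) ^ 2 * h ^ 2) + 4900980 * (t ^ 2 * (1 - t) * h ^ 2) +
        2088870 * (t ^ 3 * h ^ 2) + 1640520 * ((1 - t) ^ 4 * h) +
        13388760 * (t * (1 - t) ^ 3 * h) + 28732620 * (t ^ 2 * (1 - t) ^ 2 * h) +
        25966080 * (t ^ 3 * (1 - t) * h) + 12553800 * (t ^ 4 * h) + 793800 * (1 - t) ^ 5 +
        13097700 * (t * (1 - t) ^ 4) + 57638700 * (t ^ 2 * (1 - t) ^ 3) +
        68083050 * (t ^ 3 * (1 - t) ^ 2) + 28870800 * (t ^ 4 * (1 - t)) + 19551000 * t ^ 5"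
    unfolding G_def n_defs by algebra
  also have "\<dots> \<ge> 0"
    using t h h_half by (intro add_nonneg_nonneg mult_nonneg_nonneg zero_le_power) auto
  finally show ?thesis by simp
qed

text \<open>At X1 = t^2 / 8 this reads Q \<le> s, that is, X2 \<le> 1. In the same way
  \<open>Y2_bound\<close> gives Y2 \<le> 1, and \<open>Y1_bound\<close> gives Y1 \<le> 1 because u
  \<le> G.\<close>

lemma X2_bound: "(n02 - n22) * t ^ 2 \<le> 8 * (n22 - n42)"
proof -
  have "8 * (n22 - n42) - ((n02 - n22) * t ^ 2)
      = 112 * ((1 - t) ^ 2 * h) + 224 * (t * (1 - t) * h) + 42 * (t ^ 2 * h) + 896 * (1 - t) ^ 3 +
        3360 * (t * (1 - t) ^ 2) + 3472 * (t ^ 2 * (1 - t)) + 588 * t ^ 3"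
    unfolding n_defs by algebra
  also have "\<dots> \<ge> 0"
    using t h h_half by (intro add_nonneg_nonneg mult_nonneg_nonneg zero_le_power) auto
  finally show ?thesis by simp
qed

lemma Y1_bound: "G \<le> B"
proof -
  have "B - (G)
      = 392 * h ^ 2 + 5096 * ((1 - t) * h) + 13328 * (t * h) + 6860 * (1 - t) ^ 2 +
        72520 * (t * (1 - t)) + 109760 * t ^ 2"
    unfolding B_def G_def n_defs by algebra
  also have "\<dots> \<ge> 0"
    using t h h_half by (intro add_nonneg_nonneg mult_nonneg_nonneg zero_le_power) auto
  finally show ?thesis by simp
qed

lemma Y2_bound: "(n02 - n04) * t ^ 2 \<le> 8 * (n22 - n24)"
proof -
  have "8 * (n22 - n24) - ((n02 - n04) * t ^ 2)
      = 112 * ((1 - t) ^ 2 * h) + 224 * (t * (1 - t) * h) + 70 * (t ^ 2 * h) + 896 * (1 - t) ^ 3 +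
        4032 * (t * (1 - t) ^ 2) + 4956 * (t ^ 2 * (1 - t)) + 1400 * t ^ 3"
    unfolding n_defs by algebra
  also have "\<dots> \<ge> 0"
    using t h h_half by (intro add_nonneg_nonneg mult_nonneg_nonneg zero_le_power) auto
  finally show ?thesis by simp
qed

text \<open>Yields 1 - K / G \<ge> t, the source of the growth of r4 - r6 in the last inequality of
  \<open>residual_bounds\<close>.\<close>

lemma lambda_bound: "K \<le> (1 - t) * G"
proof -
  have "(1 - t) * G - (K)
      = 588 * ((1 - t) * h ^ 2) + 4704 * ((1 - t) ^ 2 * h) + 14112 * (t * (1 - t) * h) +
        38220 * (t * (1 - t) ^ 2) + 64680 * (t ^ 2 * (1 - t))"
    unfolding K_def G_def n_defs by algebra
  also have "\<dots> \<ge> 0"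
    using t h h_half by (intro add_nonneg_nonneg mult_nonneg_nonneg zero_le_power) auto
  finally show ?thesis by simp
qed

text \<open>This and the inequalities up to \<open>m24_lower\<close> are the estimates of
  \<open>residual0_bounds\<close> with the positive denominators n24 or n42 * G * n24
  cleared.\<close>

lemma m4_lower: "(135 + 299 * t) * n24 \<le> n40 * n24 - n22 * n42"
proof -
  have "n40 * n24 - n22 * n42 - ((135 + 299 * t) * n24)
      = 588 * ((1 - t) ^ 2 * h ^ 2) + 1176 * (t * (1 - t) * h ^ 2) + 588 * (t ^ 2 * h ^ 2) +
        1869 * ((1 - t) ^ 3 * h) + 11088 * (t * (1 - t) ^ 2 * h) + 16569 * (t ^ 2 * (1 - t) * h) +
        7350 * (t ^ 3 * h) + 315 * (1 - t) ^ 4 + 210 * (t * (1 - t) ^ 3) +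
        2415 * (t ^ 2 * (1 - t) ^ 2) + 5460 * (t ^ 3 * (1 - t)) + 2940 * t ^ 4"
    unfolding n_defs by algebra
  also have "\<dots> \<ge> 0"
    using t h h_half by (intro add_nonneg_nonneg mult_nonneg_nonneg zero_le_power) auto
  finally show ?thesis by simp
qed

lemma m2_upper: "n20 * n24 - n22 ^ 2 \<le> (252 + 536 * t + 79 * h) * n24"
proof -
  have "(252 + 536 * t + 79 * h) * n24 - (n20 * n24 - n22 ^ 2)
      = 679 * h ^ 2 + 469 * ((1 - t) * h) + 5698 * (t * h) + 196 * (1 - t) ^ 2 +
        644 * (t * (1 - t)) + 8680 * t ^ 2"
    unfolding n_defs by algebra
  also have "\<dots> \<ge> 0"
    using t h h_half by (intro add_nonneg_nonneg mult_nonneg_nonneg zero_le_power) auto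
  finally show ?thesis by simp
qed

lemma m2_lower: "(220 + 472 * t) * n24 \<le> n20 * n24 - n22 ^ 2"
proof -
  have "n20 * n24 - n22 ^ 2 - ((220 + 472 * t) * n24)
      = 980 * h ^ 2 + 5180 * ((1 - t) * h) + 12908 * (t * h) + 1820 * (1 - t) ^ 2 +
        12124 * (t * (1 - t)) + 11480 * t ^ 2"
    unfolding n_defs by algebra
  also have "\<dots> \<ge> 0"
    using t h h_half by (intro add_nonneg_nonneg mult_nonneg_nonneg zero_le_power) auto
  finally show ?thesis by simp
qed

lemma m02_lower: "(787 + 693 * t) * n42 * G * n24 \<le> (n00 - n20) * n42 * G * n24 - B ^ 2 * n24 - n22 ^ 2 * (n22 - n42) * G"
proof -
  have "(n00 - n20) * n42 * G * n24 - B ^ 2 * n24 - n22 ^ 2 * (n22 - n42) * G - ((787 + 693 * t) * n42 * G * n24)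
      = 24202080 * h ^ 5 + 376774524 * ((1 - t) * h ^ 4) + 1213561440 * (t * h ^ 4) +
        2152775016 * ((1 - t) ^ 2 * h ^ 3) + 14600077632 * (t * (1 - t) * h ^ 3) +
        22722295680 * (t ^ 2 * h ^ 3) + 5684722848 * ((1 - t) ^ 3 * h ^ 2) +
        58773195432 * (t * (1 - t) ^ 2 * h ^ 2) + 190230423264 * (t ^ 2 * (1 - t) * h ^ 2) +
        188637926400 * (t ^ 3 * h ^ 2) + 5965639848 * ((1 - t) ^ 4 * h) +
        88049587248 * (t * (1 - t) ^ 3 * h) + 434046326112 * (t ^ 2 * (1 - t) ^ 2 * h) +
        867789780480 * (t ^ 3 * (1 - t) * h) + 592466918400 * (t ^ 4 * h) +
        221708340 * (1 - t) ^ 5 + 18387530280 * (t * (1 - t) ^ 4) +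
        159519366720 * (t ^ 2 * (1 - t) ^ 3) + 460333933920 * (t ^ 3 * (1 - t) ^ 2) +
        452336875200 * (t ^ 4 * (1 - t)) + 67765824000 * t ^ 5"
    unfolding B_def G_def n_defs by algebra
  also have "\<dots> \<ge> 0"
    using t h h_half by (intro add_nonneg_nonneg mult_nonneg_nonneg zero_le_power) auto
  finally show ?thesis by simp
qed

lemma m46_lower: "49 * n24 \<le> (n40 - n60) * n24 - n42 * (n22 - n42)"
proof -
  have "(n40 - n60) * n24 - n42 * (n22 - n42) - (49 * n24)
      = 84 * ((1 - t) ^ 4 * h ^ 2) + 336 * (t * (1 - t) ^ 3 * h ^ 2) +
        504 * (t ^ 2 * (1 - t) ^ 2 * h ^ 2) + 336 * (t ^ 3 * (1 - t) * h ^ 2) +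
        84 * (t ^ 4 * h ^ 2) + 651 * ((1 - t) ^ 5 * h) + 3927 * (t * (1 - t) ^ 4 * h) +
        9198 * (t ^ 2 * (1 - t) ^ 3 * h) + 10542 * (t ^ 3 * (1 - t) ^ 2 * h) +
        5943 * (t ^ 4 * (1 - t) * h) + 1323 * (t ^ 5 * h) + 1197 * (1 - t) ^ 6 +
        4347 * (t * (1 - t) ^ 5) + 5544 * (t ^ 2 * (1 - t) ^ 4) + 2646 * (t ^ 3 * (1 - t) ^ 3) +
        189 * (t ^ 4 * (1 - t) ^ 2) + 63 * (t ^ 5 * (1 - t)) + 126 * t ^ 6"
    unfolding n_defs by algebra
  also have "\<dots> \<ge> 0"
    using t h h_half by (intro add_nonneg_nonneg mult_nonneg_nonneg zero_le_power) auto
  finally show ?thesis by simp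
qed

lemma m24_upper: "(n20 - n40) * n24 - n22 * (n22 - n42) \<le> (126 + 205 * t + 47 * h - 24 * t ^ 2) * n24"
proof -
  have "(126 + 205 * t + 47 * h - 24 * t ^ 2) * n24 - ((n20 - n40) * n24 - n22 * (n22 - n42))
      = 595 * h ^ 2 + 511 * ((1 - t) ^ 2 * h) + 6356 * (t * (1 - t) * h) + 5341 * (t ^ 2 * h) +
        1078 * (1 - t) ^ 3 + 1743 * (t * (1 - t) ^ 2) + 5943 * (t ^ 2 * (1 - t)) + 1750 * t ^ 3"
    unfolding n_defs by algebra
  also have "\<dots> \<ge> 0"
    using t h h_half by (intro add_nonneg_nonneg mult_nonneg_nonneg zero_le_power) auto
  finally show ?thesis by simp
qed

lemma m24_lower: "n22 * (n22 - n42) \<le> (n20 - n40) * n24"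
proof -
  have "(n20 - n40) * n24 - (n22 * (n22 - n42))
      = 392 * h ^ 2 + 5096 * ((1 - t) * h) + 10976 * (t * h) + 6860 * (1 - t) ^ 2 +
        46648 * (t * (1 - t)) + 62720 * t ^ 2"
    unfolding n_defs by algebra
  also have "\<dots> \<ge> 0"
    using t h h_half by (intro add_nonneg_nonneg mult_nonneg_nonneg zero_le_power) auto
  finally show ?thesis by simp
qed

text \<open>The determinants belong to the moment matrices of x, x^3, x y^2 and of y, x^2 y, y^3.
  They coincide at t = 0 by the symmetry in x and y, and the second one is zero by
  \<open>rank\<close>; subtracting it leaves a polynomial divisible by t.\<close>

lemma det_difference_lower: "94 * t ^ 2 * (n20 * n24 - n22 ^ 2) \<le> n20 * (n24 * n60 - n42 ^ 2) - n22 * (n22 * n60 - n42 * n40) + n40 * (n22 * n42 - n24 * n40) - (n02 * (n42 * n06 - n24 ^ 2) - n22 * (n22 * n06 - n24 * n04) + n04 * (n22 * n24 - n42 * n04))"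
proof -
  have "n20 * (n24 * n60 - n42 ^ 2) - n22 * (n22 * n60 - n42 * n40) + n40 * (n22 * n42 - n24 * n40) - (n02 * (n42 * n06 - n24 ^ 2) - n22 * (n22 * n06 - n24 * n04) + n04 * (n22 * n24 - n42 * n04)) - (94 * t ^ 2 * (n20 * n24 - n22 ^ 2))
      = 3724 * (t ^ 2 * h * (1 - 2 * h)) + 84672 * (t * (1 - t) * h ^ 2) +
        1185408 * (t * (1 - t) ^ 2 * h) + 2969988 * (t ^ 2 * (1 - t) * h) + 126420 * (t ^ 3 * h) +
        2963520 * (t * (1 - t) ^ 3) + 18085312 * (t ^ 2 * (1 - t) ^ 2) +
        27336512 * (t ^ 3 * (1 - t)) + 5582080 * t ^ 4"
    unfolding n_defs by algebra
  also have "\<dots> \<ge> 0"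
    using t h h_half by (intro add_nonneg_nonneg mult_nonneg_nonneg zero_le_power) auto
  finally show ?thesis by simp
qed

text \<open>The second Hankel condition after inserting the bounds for r2 - r4, r0 - r2 and r4 - r6,
  with h and \<delta> eliminated.\<close>

lemma H1_bound: "(150 + 158 * t + 24 * t ^ 2) ^ 2 \<le> (787 + 693 * t) * (49 + t ^ 3 * (12 + 47 * t))"
proof -
  have "(787 + 693 * t) * (49 + t ^ 3 * (12 + 47 * t)) - ((150 + 158 * t + 24 * t ^ 2) ^ 2)
      = 16063 * (1 - t) ^ 8 + 115061 * (t * (1 - t) ^ 7) + 323499 * (t ^ 2 * (1 - t) ^ 6) +
        426101 * (t ^ 3 * (1 - t) ^ 5) + 225474 * (t ^ 4 * (1 - t) ^ 4) +
        15830 * (t ^ 5 * (1 - t) ^ 3) + 69688 * (t ^ 6 * (1 - t) ^ 2) +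
        127348 * (t ^ 7 * (1 - t)) + 49616 * t ^ 8"
    by algebra
  also have "\<dots> \<ge> 0"
    using t h h_half by (intro add_nonneg_nonneg mult_nonneg_nonneg zero_le_power) auto
  finally show ?thesis by simp
qed

end

subsection \<open>Two-atom measures and two-point quadrature\<close>

text \<open>The atoms (x, u / B) and (Q / s, v / s) lie on the line G - K X - B Y = 0, and their
  moments divisible by Y do not depend on x. With M_i the moment of X^i, the quantity G M_i - K
  M_(i+1) is therefore fixed, so changing x alters M_i by (K / G)^(3-i) times the change of M_3. The
  terms without \<delta> are the moments for x = 0.\<close>

lemma two_atom_moments:
  fixes a b d e f x :: real
  defines "B \<equiv> a * d - b\<^sup>2" and "K \<equiv> b * e - f * a" and "G \<equiv> e * d - f * b"
  defines "s \<equiv> b - a * x" and "Q \<equiv> d - b * x"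
  defines "u \<equiv> G - K * x" and "v \<equiv> f - e * x"
  defines "\<delta> \<equiv> G\<^sup>2 * x * Q / (f * u * v)"
  defines "W1 \<equiv> B\<^sup>2 * a / ((B + s\<^sup>2) * u)" and "W2 \<equiv> s ^ 3 * a / ((B + s\<^sup>2) * v)"
  assumes nz: "B > 0" "s > 0" "u \<noteq> 0" "v \<noteq> 0" "f \<noteq> 0" "G \<noteq> 0" "d \<noteq> 0"
  shows "W1 + W2 = B\<^sup>2 / (d * G) + b ^ 3 / (d * f) + (K / G) ^ 3 * \<delta>"
    and "W1 * x + W2 * (Q / s) = b\<^sup>2 / f + (K / G)\<^sup>2 * \<delta>"
    and "W1 * x\<^sup>2 + W2 * (Q / s)\<^sup>2 = b * d / f + (K / G) * \<delta>"
    and "W1 * x ^ 3 + W2 * (Q / s) ^ 3 = d\<^sup>2 / f + \<delta>"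
proof -
  have Ds: "B + s\<^sup>2 \<noteq> 0"
    using nz(1) by (smt (verit) zero_le_power2)
  have ns: "s \<noteq> 0" using nz(2) by simp
  note ne = Ds ns nz(3-)
  note unf = s_def Q_def u_def v_def B_def K_def G_def
  have "(B\<^sup>2 * v + s ^ 3 * u) * a * (d * G * f)
    = (B + s\<^sup>2) * (B\<^sup>2 * f * u * v + b ^ 3 * G * u * v + K ^ 3 * d * x * Q)"
    unfolding unf by algebra
  then show "W1 + W2 = B\<^sup>2 / (d * G) + b ^ 3 / (d * f) + (K / G) ^ 3 * \<delta>"
    using ne by (simp add: W1_def W2_def \<delta>_def divide_simps) algebra
  have "(B\<^sup>2 * x * v + s\<^sup>2 * Q * u) * a * f = (B + s\<^sup>2) * (b\<^sup>2 * u * v + K\<^sup>2 * x * Q)"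
    unfolding unf by algebra
  then show "W1 * x + W2 * (Q / s) = b\<^sup>2 / f + (K / G)\<^sup>2 * \<delta>"
    using ne by (simp add: W1_def W2_def \<delta>_def divide_simps) algebra
  have "(B\<^sup>2 * x\<^sup>2 * v + s * Q\<^sup>2 * u) * a * f = (B + s\<^sup>2) * (b * d * u * v + K * G * x * Q)"
    unfolding unf by algebra
  then show "W1 * x\<^sup>2 + W2 * (Q / s)\<^sup>2 = b * d / f + (K / G) * \<delta>"
    using ne by (simp add: W1_def W2_def \<delta>_def divide_simps) algebra
  have "(B\<^sup>2 * x ^ 3 * v + Q ^ 3 * u) * a * f = (B + s\<^sup>2) * (d\<^sup>2 * u * v + G\<^sup>2 * x * Q)"
    unfolding unf by algebra
  then show "W1 * x ^ 3 + W2 * (Q / s) ^ 3 = d\<^sup>2 / f + \<delta>"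
    using ne by (simp add: W1_def W2_def \<delta>_def divide_simps) algebra
qed

text \<open>Normalised by \<open>m 0\<close>, the moments are those of a random variable X with
  skewness \<open>beta4 m\<close>. A two-point law with odds r^2 has skewness r - 1 / r, which
  determines the weights; mean and variance then determine the nodes. The Hankel conditions
  \<open>H0\<close> and \<open>H1\<close> place the nodes in [0,1].\<close>

lemma two_point_quadrature:
  fixes m :: "nat \<Rightarrow> real"
  assumes m0: "m 2 < m 0" and m2: "0 < m 2"
    and D: "(m 2)\<^sup>2 < m 4 * m 0"
    and H0: "(m 4)\<^sup>2 \<le> m 2 * m 6"
    and H1: "(m 2 - m 4)\<^sup>2 \<le> (m 0 - m 2) * (m 4 - m 6)"
  shows "nodes34_defined m" and "omega3 m > 0" and "omega4 m > 0"
    and "Z3 m \<in> {0..1}" and "Z4 m \<in> {0..1}"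
    and "omega3 m + omega4 m = m 0"
    and "omega3 m * Z3 m + omega4 m * Z4 m = m 2"
    and "omega3 m * (Z3 m)\<^sup>2 + omega4 m * (Z4 m)\<^sup>2 = m 4"
    and "omega3 m * Z3 m ^ 3 + omega4 m * Z4 m ^ 3 = m 6"
proof -
  have m0': "m 0 > 0" using m0 m2 by simp
  define E where "E = m 4 * m 0 - (m 2)\<^sup>2"
  have E: "E > 0" using D by (simp add: E_def)
  define q where "q = sqrt E"
  have q: "q > 0" "q\<^sup>2 = E" using E by (auto simp: q_def)
  have E32: "E powr (3 / 2) = q ^ 3"
    using E by (simp add: q_def powr_half_sqrt[symmetric] powr_powr flip: powr_realpow)
  define k where "k = beta4 m"
  have k: "m 6 * (m 0)\<^sup>2 - 3 * m 4 * m 2 * m 0 + 2 * m 2 ^ 3 = k * q ^ 3"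
    using q(1) by (simp add: k_def beta4_def E32 flip: E_def)
  \<comment> \<open>The positive root of r^2 = k r + 1; it turns out to be sqrt (omega3 /
    omega4).\<close>
  define r where "r = (sqrt (k\<^sup>2 + 4) + k) / 2"
  have S: "sqrt (k\<^sup>2 + 4) > \<bar>k\<bar>"
    by (rule real_less_rsqrt) simp
  have r: "r > 0" using S by (simp add: r_def)
  have rr: "r\<^sup>2 = k * r + 1"
  proof -
    have "sqrt (k\<^sup>2 + 4) ^ 2 = k\<^sup>2 + 4" by simp
    then show ?thesis by (simp add: r_def power2_eq_square field_simps)
  qed
  then have kr: "k = r - 1 / r"
    using r by (simp add: field_simps power2_eq_square)
  have Sr: "sqrt (k\<^sup>2 + 4) = r + 1 / r"
  proof -
    have "sqrt (k\<^sup>2 + 4) = 2 * r - k" by (simp add: r_def field_simps)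
    then show ?thesis by (simp add: kr)
  qed
  have p1: "1 + r\<^sup>2 > 0" using zero_le_power2[of r] by linarith
  have kS: "k / sqrt (k\<^sup>2 + 4) = (r\<^sup>2 - 1) / (1 + r\<^sup>2)"
    unfolding Sr unfolding kr using r p1 by (simp add: divide_simps power2_eq_square add_pos_pos add_eq_0_iff)
  have o3: "omega3 m = m 0 * r\<^sup>2 / (1 + r\<^sup>2)" and o4: "omega4 m = m 0 / (1 + r\<^sup>2)"
    unfolding omega3_def omega4_def k_def[symmetric] kS using p1 by (simp_all add: field_simps)
  show pos: "omega3 m > 0" "omega4 m > 0"
    using m0' r p1 by (simp_all add: o3 o4)
  have q34: "omega4 m / omega3 m = (1 / r)\<^sup>2" "omega3 m / omega4 m = r\<^sup>2"
    using m0' p1 r by (simp_all add: o3 o4 power_divide)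
  have Z: "Z3 m = (m 2 - q / r) / m 0" "Z4 m = (m 2 + r * q) / m 0"
    unfolding Z3_def Z4_def q34 using r by (simp_all add: q_def E_def diff_divide_distrib add_divide_distrib real_sqrt_divide)
  define y z where "y = Z3 m" and "z = Z4 m"
  have yz: "m 0 * y = m 2 - q / r" "m 0 * z = m 2 + r * q"
    using m0' by (simp_all add: y_def z_def Z)
  show s0: "omega3 m + omega4 m = m 0"
    using p1 by (simp add: o3 o4 divide_simps) (simp add: algebra_simps)
  have o34: "omega3 m = r\<^sup>2 * omega4 m" "omega4 m * (1 + r\<^sup>2) = m 0"
    using p1 by (simp_all add: o3 o4)
  define i where "i = 1 / r"
  have ri: "r * i = 1" using r by (simp add: i_def)
  have yz': "m 0 * y = m 2 - q * i" "m 0 * z = m 2 + r * q"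
    using yz by (auto simp: i_def)
  have "m 0 * (omega3 m * y + omega4 m * z) = omega4 m * (r\<^sup>2 * (m 0 * y) + m 0 * z)"
    by (simp add: o34 algebra_simps)
  also have "\<dots> = omega4 m * (1 + r\<^sup>2) * m 2"
    unfolding yz' using ri by algebra
  finally show s1: "omega3 m * Z3 m + omega4 m * Z4 m = m 2"
    using m0' by (simp add: o34 y_def z_def)
  have "(m 0)\<^sup>2 * (omega3 m * y\<^sup>2 + omega4 m * z\<^sup>2) = omega4 m * (r\<^sup>2 * (m 0 * y)\<^sup>2 + (m 0 * z)\<^sup>2)"
    by (simp add: o34 algebra_simps)
  also have "\<dots> = omega4 m * (1 + r\<^sup>2) * ((m 2)\<^sup>2 + q\<^sup>2)"
    unfolding yz' using ri by algebra
  also have "\<dots> = (m 0)\<^sup>2 * m 4"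
    unfolding o34 q E_def by (simp add: power2_eq_square)
  finally show s2: "omega3 m * (Z3 m)\<^sup>2 + omega4 m * (Z4 m)\<^sup>2 = m 4"
    using m0' by (simp add: y_def z_def)
  have "m 0 ^ 3 * (omega3 m * y ^ 3 + omega4 m * z ^ 3) = omega4 m * (r\<^sup>2 * (m 0 * y) ^ 3 + (m 0 * z) ^ 3)"
    by (simp add: o34 algebra_simps)
  also have "\<dots> = omega4 m * (1 + r\<^sup>2) * (m 2 ^ 3 + 3 * m 2 * q\<^sup>2 + k * q ^ 3)"
    unfolding yz' using ri kr[folded i_def] by algebra
  also have "\<dots> = m 0 ^ 3 * m 6"
    unfolding o34 q E_def k[symmetric] by algebra
  finally show s3: "omega3 m * Z3 m ^ 3 + omega4 m * Z4 m ^ 3 = m 6"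
    using m0' by (simp add: y_def z_def)
  have lt: "y < z"
  proof -
    have "- (q / r) < r * q" using q(1) r by (smt (verit) divide_pos_pos mult_pos_pos)
    then have "m 0 * y < m 0 * z" unfolding yz by simp
    then show ?thesis using m0' by simp
  qed
  define c where "c = omega3 m * omega4 m * (z - y)\<^sup>2"
  have c: "c > 0" using pos lt by (simp add: c_def)
  note M = s0[symmetric] s1[symmetric, folded y_def z_def] s2[symmetric, folded y_def z_def]
    s3[symmetric, folded y_def z_def]
  \<comment> \<open>The Hankel determinants of the measures weighted by X and by 1 - X factor over
    the two atoms, so their signs are those of y z and (1 - y) (1 - z).\<close>
  have "m 2 * m 6 - (m 4)\<^sup>2 = c * (y * z)"
    unfolding M c_def by algebra
  then have "0 \<le> y * z" using H0 c by (smt (verit) mult_pos_neg)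
  have "(m 0 - m 2) * (m 4 - m 6) - (m 2 - m 4)\<^sup>2 = c * ((1 - y) * (1 - z))"
    unfolding M c_def by algebra
  then have "0 \<le> (1 - y) * (1 - z)" using H1 c by (smt (verit) mult_pos_neg)
  \<comment> \<open>The product y z \<ge> 0 leaves open that both nodes are negative; the positive
    first moment excludes this. The mean of 1 - X plays the same part at the other end.\<close>
  have "0 < omega3 m * y + omega4 m * z" using m2 s1 by (simp add: y_def z_def)
  have z0: "0 < z"
  proof (rule ccontr)
    assume "\<not> 0 < z"
    then have "omega3 m * y \<le> 0" "omega4 m * z \<le> 0"
      using lt pos by (auto intro!: mult_nonneg_nonpos)
    then show False using \<open>0 < omega3 m * y + omega4 m * z\<close> by linarith
  qed
  have "0 < omega3 m * (1 - y) + omega4 m * (1 - z)" using m0 s0 s1 by (simp add: y_def z_def algebra_simps)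
  have y1: "y < 1"
  proof (rule ccontr)
    assume "\<not> y < 1"
    then have "omega3 m * (1 - y) \<le> 0" "omega4 m * (1 - z) \<le> 0"
      using lt pos by (auto intro!: mult_nonneg_nonpos)
    then show False using \<open>0 < omega3 m * (1 - y) + omega4 m * (1 - z)\<close> by linarith
  qed
  have "0 \<le> y" using \<open>0 \<le> y * z\<close> z0 by (simp add: zero_le_mult_iff)
  have "z \<le> 1" using \<open>0 \<le> (1 - y) * (1 - z)\<close> y1 by (simp add: zero_le_mult_iff)
  show Zs: "Z3 m \<in> {0..1}" "Z4 m \<in> {0..1}"
    using \<open>0 \<le> y\<close> \<open>z \<le> 1\<close> z0 y1 by (auto simp: y_def z_def)
  show "nodes34_defined m"
    using pos m0' D Zs by (auto simp: nodes34_defined_def)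
qed

subsection \<open>Nodes 1 and 2\<close>

text \<open>The constant that selects a member of the two-atom family enters all later estimates
  through this enclosure.\<close>

lemma sqrt30_bounds: "2077 / 10000 < (sqrt 30 + 2) / 36" "(sqrt 30 + 2) / 36 < 2078 / 10000"
proof -
  have "54772 / 10000 < sqrt 30" by (rule real_less_rsqrt) (simp add: power2_eq_square)
  moreover have "sqrt 30 < 54808 / 10000" by (rule real_less_lsqrt) (simp_all add: power2_eq_square)
  ultimately show "2077 / 10000 < (sqrt 30 + 2) / 36" "(sqrt 30 + 2) / 36 < 2078 / 10000"
    by simp_all
qed

lemma concave_parabola_strict_mono:
  fixes a b x y :: real
  assumes "x < y" "a * x < b" "a * y \<le> b"
  shows "x * (2 * b - a * x) < y * (2 * b - a * y)"
proof -
  have "y * (2 * b - a * y) - x * (2 * b - a * x) = (y - x) * ((b - a * x) + (b - a * y))"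
    by algebra
  also have "\<dots> > 0"
    using assms by (intro mult_pos_pos add_pos_nonneg) auto
  finally show ?thesis by simp
qed

context quartic_root
begin

definition "beta = 1 - n22\<^sup>2 / (n42 * n02) + (sqrt 30 + 2) / 36 * t\<^sup>2"
text \<open>By \<open>rank\<close>, every inner root in the formulas for nodes 1 and 2 is a multiple
  of s or of 1 / s, see \<open>sqrt_forms\<close>.\<close>

definition "s = sqrt ((1 - beta) * B / beta)"
definition "X1 = (n22 - s) / n02"
definition "Y1 = (n04 + s * K / B) / n02"
definition "X2 = (n22 + B / s) / n02"
definition "Y2 = (n04 - K / s) / n02"

text \<open>\<open>X1 = 0\<close> iff \<open>excess = 0\<close>; see \<open>X1_equation\<close>.\<close>

definition "excess = (sqrt 30 + 2) / 36 * t\<^sup>2 * (n02 * n42)"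

lemma excess_bounds: "0 \<le> excess" "2077 / 10000 * (t\<^sup>2 * n02 * n42) \<le> excess"
    "excess \<le> 2078 / 10000 * (t\<^sup>2 * n02 * n42)" "excess < n22\<^sup>2"
proof -
  have *: "0 \<le> t\<^sup>2 * n02 * n42" using n_pos by simp
  have e: "excess = (sqrt 30 + 2) / 36 * (t\<^sup>2 * n02 * n42)" by (simp add: excess_def)
  show "2077 / 10000 * (t\<^sup>2 * n02 * n42) \<le> excess" "excess \<le> 2078 / 10000 * (t\<^sup>2 * n02 * n42)"
    unfolding e by (rule mult_right_mono[OF less_imp_le[OF sqrt30_bounds(1)] *],
        rule mult_right_mono[OF less_imp_le[OF sqrt30_bounds(2)] *])
  then show "0 \<le> excess" "excess < n22\<^sup>2" using * beta_bound by (auto simp: mult.assoc)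
qed

lemma beta_eq: "beta = (B + excess) / (n02 * n42)" "1 - beta = (n22\<^sup>2 - excess) / (n02 * n42)"
  using n_pos by (simp_all add: beta_def B_def excess_def field_simps)

lemma beta01: "0 < beta" "beta < 1"
proof -
  have "0 < 1 - beta" unfolding beta_eq(2) using n_pos excess_bounds by simp
  then show "beta < 1" by simp
  show "0 < beta" unfolding beta_eq(1) using n_pos excess_bounds BG_pos by (simp add: add_pos_nonneg)
qed

lemma s_pos: "s > 0"
  using beta01 BG_pos by (simp add: s_def)

lemma s_sq: "s\<^sup>2 * (B + excess) = (n22\<^sup>2 - excess) * B"
proof -
  have "s\<^sup>2 * beta = (1 - beta) * B"
    using beta01 BG_pos by (simp add: s_def)
  then show ?thesis
    unfolding beta_eq(2) unfolding beta_eq(1) using n_pos by (simp add: field_simps)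
qed

lemma beta_s: "beta = B / (B + s\<^sup>2)" "1 - beta = s\<^sup>2 / (B + s\<^sup>2)"
proof -
  have "s\<^sup>2 * beta = (1 - beta) * B"
    using beta01 BG_pos by (simp add: s_def)
  moreover have "B + s\<^sup>2 > 0" using BG_pos by (simp add: add_pos_nonneg)
  ultimately show "beta = B / (B + s\<^sup>2)" "1 - beta = s\<^sup>2 / (B + s\<^sup>2)"
    by (simp_all add: field_simps)
qed

lemma s_X1: "s = n22 - n02 * X1"
  using n_pos by (simp add: X1_def)

text \<open>Eliminating the root s leaves a quadratic equation for X1. Its left side increases up to
  the vertex n22 / n02, and X1 lies to the left of the vertex since s > 0; hence bounds for X1 can
  be tested at trial points.\<close>

lemma X1_equation: "X1 * (2 * n22 - n02 * X1) * (B + excess) = excess * n42"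
proof -
  have "n02 * (X1 * (2 * n22 - n02 * X1) * (B + excess)) = n22\<^sup>2 * (B + excess) - s\<^sup>2 * (B + excess)"
    unfolding s_X1 by algebra
  also have "\<dots> = n22\<^sup>2 * (B + excess) - (n22\<^sup>2 - excess) * B"
    by (simp only: s_sq)
  also have "\<dots> = n02 * (excess * n42)"
    unfolding B_def by algebra
  finally show ?thesis using n_pos by simp
qed

lemma X1_nonneg: "0 \<le> X1"
proof -
  have "s\<^sup>2 * (B + excess) \<le> n22\<^sup>2 * (B + excess)"
    unfolding s_sq using excess_bounds(1) n_pos BG_pos by (simp add: algebra_simps)
  then have "s\<^sup>2 \<le> n22\<^sup>2"
    using excess_bounds(1) BG_pos by simp
  then have "s \<le> n22"
    by (rule power2_le_imp_le) (use n_pos in simp)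
  then show ?thesis using n_pos by (simp add: X1_def)
qed

lemma X1_upper: "X1 \<le> t\<^sup>2 / 8"
proof (rule ccontr)
  assume *: "\<not> X1 \<le> t\<^sup>2 / 8"
  have sx: "n02 * X1 < n22" using s_pos s_X1 by simp
  have "(t\<^sup>2 / 8) * (2 * n22 - n02 * (t\<^sup>2 / 8)) < X1 * (2 * n22 - n02 * X1)"
  proof -
    have "n02 * (t\<^sup>2 / 8) < n22"
      using * sx n_pos by (smt (verit) mult_strict_left_mono)
    then show ?thesis
      using * sx by (intro concave_parabola_strict_mono) auto
  qed
  then have "(t\<^sup>2 / 8) * (2 * n22 - n02 * (t\<^sup>2 / 8)) * (B + excess) < excess * n42"
    unfolding X1_equation[symmetric]
    by (rule mult_strict_right_mono) (use BG_pos excess_bounds(1) in simp)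
  also have "\<dots> \<le> 2078 / 10000 * (t\<^sup>2 * n02 * n42) * n42"
    using excess_bounds n_pos by (intro mult_right_mono) auto
  also have "\<dots> = t\<^sup>2 * (64 * 2078 * (n02 * n42\<^sup>2)) / 640000"
    by (simp add: power2_eq_square)
  also have "\<dots> \<le> t\<^sup>2 * ((16 * n22 - t\<^sup>2 * n02) * (10000 * B + 2077 * (t\<^sup>2 * n02 * n42))) / 640000"
    using X1_hi_bound by (intro divide_right_mono mult_left_mono) auto
  also have "\<dots> = (t\<^sup>2 / 8) * (2 * n22 - n02 * (t\<^sup>2 / 8)) * (B + 2077 / 10000 * (t\<^sup>2 * n02 * n42))"
    by (simp add: field_simps)
  also have "\<dots> \<le> (t\<^sup>2 / 8) * (2 * n22 - n02 * (t\<^sup>2 / 8)) * (B + excess)"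
    using excess_bounds(2) X1_hi_mean n_pos by (intro mult_left_mono mult_nonneg_nonneg) (auto simp: mult.commute)
  finally show False by simp
qed

lemma X1_lower: "t\<^sup>2 / 10 \<le> X1"
proof (rule ccontr)
  assume *: "\<not> t\<^sup>2 / 10 \<le> X1"
  have sx: "n02 * (t\<^sup>2 / 10) \<le> n22" using X1_hi_mean n_pos by (simp add: mult.commute)
  have le: "X1 * (2 * n22 - n02 * X1) \<le> (t\<^sup>2 / 10) * (2 * n22 - n02 * (t\<^sup>2 / 10))"
  proof -
    have "X1 * (2 * n22 - n02 * X1) < (t\<^sup>2 / 10) * (2 * n22 - n02 * (t\<^sup>2 / 10))"
      using * sx s_X1 s_pos by (intro concave_parabola_strict_mono) auto
    then show ?thesis by simp
  qed
  \<comment> \<open>For t = 0 the claim is \<open>X1_nonneg\<close>; for other t the strict bound on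
    sqrt 30 gives the contradiction.\<close>
  have t0: "t \<noteq> 0" using * X1_nonneg by auto
  have "excess * n42 \<le> (t\<^sup>2 / 10) * (2 * n22 - n02 * (t\<^sup>2 / 10)) * (B + excess)"
    unfolding X1_equation[symmetric] using BG_pos excess_bounds(1) le by (intro mult_right_mono) auto
  also have "\<dots> \<le> (t\<^sup>2 / 10) * (2 * n22 - n02 * (t\<^sup>2 / 10)) * (B + 2078 / 10000 * (t\<^sup>2 * n02 * n42))"
    using excess_bounds(3) sx n_pos by (intro mult_left_mono mult_nonneg_nonneg) auto
  also have "\<dots> = t\<^sup>2 * ((20 * n22 - t\<^sup>2 * n02) * (10000 * B + 2078 * (t\<^sup>2 * n02 * n42))) / 1000000"
    by (simp add: field_simps)
  also have "\<dots> \<le> t\<^sup>2 * (100 * 2077 * (n02 * n42\<^sup>2)) / 1000000"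
    using X1_lo_bound by (intro divide_right_mono mult_left_mono) auto
  also have "\<dots> = 2077 / 10000 * (t\<^sup>2 * n02 * n42) * n42"
    by (simp add: power2_eq_square)
  also have "\<dots> < excess * n42"
    using sqrt30_bounds(1) t0 n_pos by (simp add: excess_def)
  finally show False by simp
qed

text \<open>Numerators linear in X1 for the other coordinates: X2 = Q / s, Y1 = u / B, Y2 = v /
  s.\<close>

definition "Q = n42 - n22 * X1"
definition "u = G - K * X1"
definition "v = n24 - n04 * X1"

lemma Q_pos: "Q > 0"
proof -
  have "n02 * Q = B + n22 * s"
    unfolding Q_def s_X1 B_def by algebra
  then show ?thesis
    using BG_pos n_pos s_pos by (metis add_pos_pos mult_pos_pos zero_less_mult_pos)
qed

lemma lambda: "0 \<le> K / G" "K / G \<le> 1 - t"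
  using lambda_bound K_nonneg BG_pos by (simp_all add: field_simps)

lemma v_pos: "v > 0"
proof -
  have "n04 * X1 \<le> n04 * (t\<^sup>2 / 8)" using X1_upper n_pos by (intro mult_left_mono) auto
  then show ?thesis using X1_hi_n24 by (simp add: v_def)
qed

lemma u_bounds: "49 / 50 * G \<le> u" "u \<le> G" "u > 0"
proof -
  have "K * X1 \<le> ((1 - t) * G) * (t\<^sup>2 / 8)"
    using lambda_bound X1_upper X1_nonneg t BG_pos K_nonneg by (intro mult_mono) auto
  also have "\<dots> \<le> 1 / 50 * G"
  proof -
    \<comment> \<open>The maximum of t^2 (1 - t) on [0,1] is 4 / 27, attained at t = 2 / 3; one
      eighth of it is 1 / 54.\<close>
    have "0 \<le> 4 / 27 - t\<^sup>2 * (1 - t)"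
    proof -
      have "4 / 27 - t\<^sup>2 * (1 - t) = (t - 2 / 3)\<^sup>2 * (t + 1 / 3)"
        by (simp add: field_simps power2_eq_square)
      then show ?thesis using t by simp
    qed
    then have "(1 - t) * (t\<^sup>2 / 8) \<le> 1 / 50" by (simp add: mult.commute)
    then show ?thesis using BG_pos mult_right_mono[of "(1 - t) * (t\<^sup>2 / 8)" "1 / 50" G] by (simp add: algebra_simps)
  qed
  finally show "49 / 50 * G \<le> u" by (simp add: u_def)
  then show "u > 0" using BG_pos by simp
  show "u \<le> G" using K_nonneg X1_nonneg by (simp add: u_def)
qed

lemma X2_eq: "X2 = Q / s" and Y1_eq: "Y1 = u / B" and Y2_eq: "Y2 = v / s"
proof -
  have "n02 * Q = n22 * s + B" "n02 * u = n04 * B + s * K" "n02 * v = n04 * s - K"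
    unfolding Q_def u_def v_def s_X1 B_def K_def G_def by algebra+
  then have "Q = (n22 * s + B) / n02" "u = (n04 * B + s * K) / n02" "v = (n04 * s - K) / n02"
    using n_pos by (simp_all add: field_simps)
  then show "X2 = Q / s" "Y1 = u / B" "Y2 = v / s"
    unfolding X2_def Y1_def Y2_def using n_pos s_pos BG_pos by (simp_all only:) (simp_all add: field_simps)
qed

lemma nodes12_range: "X1 \<in> {0..1}" "X2 \<in> {0..1}" "Y1 \<in> {0<..1}" "Y2 \<in> {0<..1}"
proof -
  have "t\<^sup>2 \<le> 1" using t by (simp add: power_le_one)
  then show "X1 \<in> {0..1}" using X1_nonneg X1_upper by auto
  have gt: "n02 - n22 \<ge> 0" "n02 - n04 \<ge> 0" using t h by (simp_all add: n_defs)
  note mult_left_mono[OF X1_upper gt(1)] mult_left_mono[OF X1_upper gt(2)]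
  then have "Q \<le> s" "v \<le> s"
    using X2_bound Y2_bound by (auto simp: s_X1 Q_def v_def algebra_simps)
  then show "X2 \<in> {0..1}" "Y2 \<in> {0<..1}"
    using Q_pos v_pos s_pos by (simp_all add: X2_eq Y2_eq)
  show "Y1 \<in> {0<..1}"
    using Y1_bound u_bounds BG_pos by (simp add: Y1_eq)
qed

text \<open>The drop b6 - r6 of the highest residual moment relative to the member of the family
  with X1 = 0. By \<open>residual_eq\<close> it governs the changes of the lower moments
  too.\<close>

definition "\<delta> = G\<^sup>2 * X1 * Q / (n24 * u * v)"

lemma delta_bounds: "t\<^sup>2 * (12 + 47 * t) \<le> \<delta>" "\<delta> \<le> 94 * t\<^sup>2"
proof -
  \<comment> \<open>A Moebius function of x whose determinant is G > 0, hence nondecreasing left of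
    its pole. Together with the bounds for X1 this reduces both estimates to the trial points t^2 /
    8 and t^2 / 10.\<close>
  have mono: "(n42 - n22 * x) / (n24 - n04 * x) \<le> (n42 - n22 * y) / (n24 - n04 * y)"
    if "x \<le> y" "n24 - n04 * y > 0" for x y
  proof -
    have "(n42 - n22 * y) * (n24 - n04 * x) - (n42 - n22 * x) * (n24 - n04 * y) = G * (y - x)"
      unfolding G_def by algebra
    also have "\<dots> \<ge> 0" using that BG_pos by simp
    finally have "(n42 - n22 * x) * (n24 - n04 * y) \<le> (n42 - n22 * y) * (n24 - n04 * x)" by simp
    moreover have "n04 * x \<le> n04 * y"
      using that n_pos by (intro mult_left_mono) auto
    then have "n24 - n04 * x > 0"
      using that by linarith
    ultimately show ?thesis using that by (simp add: divide_simps mult.commute)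
  qed
  define a b where "a = t\<^sup>2 / 8" and "b = t\<^sup>2 / 10"
  have va: "n24 - n04 * a > 0" using X1_hi_n24 by (simp add: a_def)
  have vb: "n24 - n04 * b > 0" using va n_pos by (simp add: a_def b_def)
  have Gu: "G / u \<le> 50 / 49" "1 \<le> G / u"
    using u_bounds BG_pos by (simp_all add: field_simps)
  define w where "w = G * (Q / v)"
  have w: "w > 0" using BG_pos Q_pos v_pos by (simp add: w_def)
  have d: "\<delta> = G / u * X1 * w / n24"
    by (simp add: \<delta>_def w_def power2_eq_square ac_simps)
  have "w \<le> G * ((n42 - n22 * a) / (n24 - n04 * a))"
    unfolding w_def Q_def v_def using X1_upper va BG_pos by (intro mult_left_mono mono) (auto simp: a_def)
  also have "\<dots> = G * (n42 - n22 * a) / (n24 - n04 * a)" by simp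
  also have "\<dots> \<le> 18424 / 25 * n24"
    unfolding pos_divide_le_eq[OF va] using delta_hi_bound by (simp add: a_def algebra_simps)
  finally have QV: "w \<le> 18424 / 25 * n24" .
  have "G / u * X1 * w \<le> 50 / 49 * a * (18424 / 25 * n24)"
    using Gu(1) QV X1_upper X1_nonneg w
    by (intro mult_mono[of "G / u * X1" "50 / 49 * a"] mult_mono[of "G / u"]) (auto simp: a_def)
  then show "\<delta> \<le> 94 * t\<^sup>2"
    unfolding d pos_divide_le_eq[OF n_pos(5)] by (simp add: a_def mult_ac)
  have "10 * (12 + 47 * t) * n24 \<le> G * (n42 - n22 * b) / (n24 - n04 * b)"
    unfolding pos_le_divide_eq[OF vb] using delta_lo_bound by (simp add: b_def algebra_simps)
  also have "\<dots> = G * ((n42 - n22 * b) / (n24 - n04 * b))" by simp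
  also have "\<dots> \<le> w"
    unfolding w_def Q_def v_def using X1_lower v_pos[unfolded v_def] BG_pos
    by (intro mult_left_mono mono) (auto simp: b_def)
  finally have QV: "10 * (12 + 47 * t) * n24 \<le> w" .
  have "t\<^sup>2 * (12 + 47 * t) * n24 = 1 * b * (10 * (12 + 47 * t) * n24)"
    by (simp add: b_def)
  also have "\<dots> \<le> G / u * X1 * w"
    using Gu(2) QV X1_lower X1_nonneg t n_pos u_bounds BG_pos
    by (intro mult_mono[of "1 * b" "G / u * X1"] mult_mono[of 1 "G / u"]) (auto simp: b_def)
  finally show "t\<^sup>2 * (12 + 47 * t) \<le> \<delta>"
    unfolding d pos_le_divide_eq[OF n_pos(5)] .
qed

end

subsection \<open>Residual moments\<close>

context quartic_root
begin

definition "W1 = beta * n02 / Y1"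
definition "W2 = (1 - beta) * n02 / Y2"

lemma W_eq: "W1 = B\<^sup>2 * n02 / ((B + s\<^sup>2) * u)" "W2 = s ^ 3 * n02 / ((B + s\<^sup>2) * v)"
  unfolding W1_def W2_def Y1_eq Y2_eq beta_s(2) unfolding beta_s(1)
  by (simp_all add: power2_eq_square power3_eq_cube)

lemma W_pos: "W1 > 0" "W2 > 0"
  unfolding W1_def W2_def using beta01 n_pos nodes12_range by simp_all

text \<open>The residual moments for \<open>\<delta> = 0\<close>, that is, for \<open>X1 = 0\<close>.\<close>

definition "b0 = n00 - B\<^sup>2 / (n42 * G) - n22 ^ 3 / (n42 * n24)"
definition "b2 = n20 - n22\<^sup>2 / n24"
definition "b4 = n40 - n22 * n42 / n24"
definition "b6 = n60 - n42\<^sup>2 / n24"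

definition "r0 = n00 - (W1 + W2)"
definition "r2 = n20 - (W1 * X1 + W2 * X2)"
definition "r4 = n40 - (W1 * X1\<^sup>2 + W2 * X2\<^sup>2)"
definition "r6 = n60 - (W1 * X1 ^ 3 + W2 * X2 ^ 3)"

lemma residual_eq:
  "r0 = b0 - (K / G) ^ 3 * \<delta>" "r2 = b2 - (K / G)\<^sup>2 * \<delta>" "r4 = b4 - (K / G) * \<delta>" "r6 = b6 - \<delta>"
proof -
  note T = two_atom_moments[where a = n02 and b = n22 and d = n42 and e = n04 and f = n24 and x = X1, folded B_def K_def G_def s_X1,
      folded Q_def u_def v_def, folded \<delta>_def W_eq X2_eq]
  have nz: "u \<noteq> 0" "v \<noteq> 0" "n24 \<noteq> 0" "G \<noteq> 0" "n42 \<noteq> 0"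
    using u_bounds v_pos n_pos BG_pos by auto
  note T = T[OF BG_pos(1) s_pos nz]
  show "r0 = b0 - (K / G) ^ 3 * \<delta>" "r2 = b2 - (K / G)\<^sup>2 * \<delta>" "r4 = b4 - (K / G) * \<delta>" "r6 = b6 - \<delta>"
    unfolding r0_def r2_def r4_def r6_def T b0_def b2_def b4_def b6_def by simp_all
qed

lemma residual0_bounds:
  "135 + 299 * t \<le> b4" "b2 \<le> 252 + 536 * t + 79 * h" "220 + 472 * t \<le> b2"
  "787 + 693 * t \<le> b0 - b2" "49 \<le> b4 - b6"
  "0 \<le> b2 - b4" "b2 - b4 \<le> 126 + 205 * t + 47 * h - 24 * t\<^sup>2"
proof -
  have b: "b2 = (n20 * n24 - n22\<^sup>2) / n24" "b4 = (n40 * n24 - n22 * n42) / n24"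
    "b4 - b6 = ((n40 - n60) * n24 - n42 * (n22 - n42)) / n24"
    "b2 - b4 = ((n20 - n40) * n24 - n22 * (n22 - n42)) / n24"
    "b0 - b2 = ((n00 - n20) * n42 * G * n24 - B\<^sup>2 * n24 - n22\<^sup>2 * (n22 - n42) * G) / (n42 * G * n24)"
    unfolding b0_def b2_def b4_def b6_def using n_pos BG_pos
    by (simp_all add: divide_simps) algebra+
  have p: "n42 * G * n24 > 0" using n_pos BG_pos by simp
  note div = pos_le_divide_eq[OF n_pos(5)] pos_divide_le_eq[OF n_pos(5)]
  show "135 + 299 * t \<le> b4" "b2 \<le> 252 + 536 * t + 79 * h" "220 + 472 * t \<le> b2"
    unfolding b(1,2) div using m4_lower m2_upper m2_lower by auto
  show "49 \<le> b4 - b6" "0 \<le> b2 - b4" "b2 - b4 \<le> 126 + 205 * t + 47 * h - 24 * t\<^sup>2"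
    unfolding b(3,4) div using m46_lower m24_lower m24_upper by auto
  show "787 + 693 * t \<le> b0 - b2"
    unfolding b(5) pos_le_divide_eq[OF p] using m02_lower by (simp add: mult_ac)
qed

text \<open>The numbers b2, b4, b6 form the Schur complement of n24 in the moment matrix of x, x^3,
  x y^2, so the right side is the determinant of that matrix divided by n24.\<close>

lemma residual0_det: "94 * t\<^sup>2 * b2 \<le> b2 * b6 - b4\<^sup>2"
proof -
  have "n02 * (n02 * (n42 * n06 - n24\<^sup>2) - n22 * (n22 * n06 - n24 * n04) + n04 * (n22 * n24 - n42 * n04))
      = B * (n02 * n06 - n04\<^sup>2) - K\<^sup>2"
    unfolding B_def K_def by algebra
  then have "n02 * (n42 * n06 - n24\<^sup>2) - n22 * (n22 * n06 - n24 * n04) + n04 * (n22 * n24 - n42 * n04) = 0"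
    using rank n_pos by simp
  then have le: "94 * t\<^sup>2 * (n20 * n24 - n22\<^sup>2)
      \<le> n20 * (n24 * n60 - n42\<^sup>2) - n22 * (n22 * n60 - n42 * n40) + n40 * (n22 * n42 - n24 * n40)"
    using det_difference_lower by simp
  have "94 * t\<^sup>2 * b2 = 94 * t\<^sup>2 * (n20 * n24 - n22\<^sup>2) / n24"
    unfolding b2_def using n_pos by (simp add: field_simps)
  also have "\<dots> \<le> (n20 * (n24 * n60 - n42\<^sup>2) - n22 * (n22 * n60 - n42 * n40) + n40 * (n22 * n42 - n24 * n40)) / n24"
    using le n_pos by (intro divide_right_mono) auto
  also have "\<dots> = b2 * b6 - b4\<^sup>2"
    unfolding b2_def b4_def b6_def using n_pos by (simp add: divide_simps) algebra
  finally show ?thesis .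
qed

text \<open>The hypotheses of \<open>two_point_quadrature\<close>, before scaling by the boundary
  weight. With l = K / G the corrections to r0, r2, r4 are at most 47 t / 2, which settles the first
  three; the two Hankel conditions need both bounds on \<delta>.\<close>

lemma residual_bounds:
  "r2 < r0" "0 < r2" "r2\<^sup>2 < r4 * r0" "r4\<^sup>2 \<le> r2 * r6" "(r2 - r4)\<^sup>2 \<le> (r0 - r2) * (r4 - r6)"
proof -
  define l where "l = K / G"
  have l: "0 \<le> l" "l \<le> 1 - t" "l \<le> 1" using lambda t by (auto simp: l_def)
  have \<delta>: "0 \<le> \<delta>" "t\<^sup>2 * (12 + 47 * t) \<le> \<delta>" "\<delta> \<le> 94 * t\<^sup>2"
  proof -
    have "0 \<le> t\<^sup>2 * (12 + 47 * t)" using t by simp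
    then show "0 \<le> \<delta>" using delta_bounds(1) by (rule order_trans)
  qed (rule delta_bounds)+
  note r = residual_eq[folded l_def]
  have ld: "0 \<le> l * \<delta>" "l * \<delta> \<le> 47 / 2 * t"
  proof -
    show "0 \<le> l * \<delta>" using l \<delta> by simp
    have "l * \<delta> \<le> (1 - t) * (94 * t\<^sup>2)"
      using l \<delta> t by (intro mult_mono) auto
    also have "\<dots> = 94 * t * (t * (1 - t))" by (simp add: power2_eq_square)
    also have "\<dots> \<le> 94 * t * (1 / 4)"
    proof -
      have "1 / 4 - t * (1 - t) = (t - 1 / 2)\<^sup>2" by (simp add: power2_eq_square field_simps)
      then have "t * (1 - t) \<le> 1 / 4" by (metis diff_ge_0_iff_ge zero_le_power2)
      then show ?thesis using t by (intro mult_left_mono) auto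
    qed
    finally show "l * \<delta> \<le> 47 / 2 * t" by simp
  qed
  have l2d: "0 \<le> l\<^sup>2 * \<delta>" "l\<^sup>2 * \<delta> \<le> l * \<delta>"
    using l \<delta> by (auto intro!: mult_right_mono simp: power2_eq_square mult_left_le)
  have l3d: "l ^ 3 * \<delta> \<le> l\<^sup>2 * \<delta>"
    using l \<delta> by (intro mult_right_mono power_decreasing) auto
  have h1: "79 * h \<le> 79 / 2 * (1 - 2 * t + t\<^sup>2)" "47 * h \<le> 47 / 2 * (1 - 2 * t + t\<^sup>2)"
    using h by (simp_all add: power2_eq_square algebra_simps)
  have tt: "0 \<le> t\<^sup>2" "t\<^sup>2 \<le> t" using t by (auto simp: power2_eq_square mult_left_le)
  have r02: "787 + 693 * t \<le> r0 - r2"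
    using residual0_bounds l3d r by simp
  then show "r2 < r0" using t by simp
  have r2l: "0 < r2" using residual0_bounds(3) l2d ld t r(2) by simp
  then show "0 < r2" .
  have r2u: "r2 \<le> 292 + 497 * t" using residual0_bounds(2) l2d h1 tt t r(2) by simp
  have r0l: "1007 + 1141 * t \<le> r0" using r02 residual0_bounds(3) l2d ld t r(2) by simp
  have r4l: "135 + 275 * t \<le> r4" using residual0_bounds(1) ld t r(3) by simp
  have "r2\<^sup>2 \<le> (292 + 497 * t)\<^sup>2" using r2u r2l by (intro power_mono) auto
  also have "\<dots> < (292 + 497 * t)\<^sup>2 + (50681 + 140712 * t + 66766 * t\<^sup>2)"
    using t by (simp add: add_pos_nonneg)
  also have "\<dots> = (135 + 275 * t) * (1007 + 1141 * t)"
    by algebra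
  also have "\<dots> \<le> r4 * r0" using r4l r0l t by (intro mult_mono) auto
  finally show "r2\<^sup>2 < r4 * r0" .
  \<comment> \<open>The terms quadratic in \<delta> cancel, so the determinant drops by \<delta> (b2
    + l^2 b6 - 2 l b4), which is at most \<delta> b2. The bound \<delta> \<le> 94 t^2 matches the
    reserve provided by \<open>residual0_det\<close>.\<close>
  show "r4\<^sup>2 \<le> r2 * r6"
  proof -
    have b4: "0 \<le> b4" "b6 \<le> b4" using residual0_bounds t by auto
    have "l * b6 \<le> l * b4" using b4 l by (intro mult_left_mono) auto
    also have "\<dots> \<le> 1 * b4" using b4 l by (intro mult_right_mono) auto
    finally have "l * (l * b6 - 2 * b4) \<le> 0" using b4 l by (intro mult_nonneg_nonpos) auto
    then have "\<delta> * (b2 + l\<^sup>2 * b6 - 2 * l * b4) \<le> \<delta> * b2"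
      using \<delta> by (intro mult_left_mono) (auto simp: power2_eq_square algebra_simps)
    also have "\<dots> \<le> 94 * t\<^sup>2 * b2"
      using \<delta> residual0_bounds(3) t by (intro mult_right_mono) auto
    also have "\<dots> \<le> b2 * b6 - b4\<^sup>2" by (rule residual0_det)
    also have "b2 * b6 - b4\<^sup>2 = r2 * r6 - r4\<^sup>2 + \<delta> * (b2 + l\<^sup>2 * b6 - 2 * l * b4)"
      unfolding r by algebra
    finally show ?thesis by simp
  qed
  show "(r2 - r4)\<^sup>2 \<le> (r0 - r2) * (r4 - r6)"
  proof -
    have ll: "0 \<le> l * (1 - l)" "l * (1 - l) \<le> 1 / 4"
    proof -
      show "0 \<le> l * (1 - l)" using l by simp
      have "1 / 4 - l * (1 - l) = (l - 1 / 2)\<^sup>2" by (simp add: power2_eq_square field_simps)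
      then show "l * (1 - l) \<le> 1 / 4" by (metis diff_ge_0_iff_ge zero_le_power2)
    qed
    \<comment> \<open>The correction of r2 - r4; the factor l (1 - l) is at most 1 / 4.\<close>
    define d where "d = l * (1 - l) * \<delta>"
    have e: "r2 - r4 = b2 - b4 + d" "r4 - r6 = b4 - b6 + (1 - l) * \<delta>"
      unfolding r d_def by (simp_all add: power2_eq_square algebra_simps)
    have "d \<le> 1 / 4 * (94 * t\<^sup>2)" unfolding d_def using ll \<delta> by (intro mult_mono) auto
    then have "r2 - r4 \<le> 299 / 2 + 158 * t + 23 * t\<^sup>2"
      unfolding e(1) using residual0_bounds(7) h1(2) by (simp add: algebra_simps)
    also have "\<dots> \<le> 150 + 158 * t + 24 * t\<^sup>2"
      by simp
    finally have up: "r2 - r4 \<le> 150 + 158 * t + 24 * t\<^sup>2" .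
    have "0 \<le> d" using ll \<delta> by (simp add: d_def)
    then have "0 \<le> r2 - r4" using residual0_bounds(6) e(1) by simp
    then have "(r2 - r4)\<^sup>2 \<le> (150 + 158 * t + 24 * t\<^sup>2)\<^sup>2"
      using up by (intro power_mono) auto
    also have "\<dots> \<le> (787 + 693 * t) * (49 + t ^ 3 * (12 + 47 * t))" by (rule H1_bound)
    also have "\<dots> \<le> (r0 - r2) * (r4 - r6)"
    proof (intro mult_mono)
      \<comment> \<open>Here l \<le> 1 - t is used as t \<le> 1 - l.\<close>
      have "t * (t\<^sup>2 * (12 + 47 * t)) \<le> (1 - l) * \<delta>"
        using l \<delta> t by (intro mult_mono) auto
      then show "49 + t ^ 3 * (12 + 47 * t) \<le> r4 - r6"
        using residual0_bounds(5) e(2) by (simp add: power2_eq_square power3_eq_cube)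
    qed (use r02 t in auto)
    finally show ?thesis .
  qed
qed

end

subsection \<open>Cubature identities and duality\<close>

lemma bpoly_monom:
  assumes "i + j \<le> k"
  shows "(\<lambda>x y. c * x ^ i * y ^ j) \<in> bpoly k"
proof -
  have "(\<Sum>j'\<le>k - i'. (if i' = i \<and> j' = j then c else 0) * x ^ i' * y ^ j')
      = (if i' = i then c * x ^ i * y ^ j else 0)" for i' x y
  proof (cases "i' = i")
    case True
    have "(\<Sum>j'\<le>k - i. (if j' = j then c else 0) * x ^ i * y ^ j')
        = (\<Sum>j'\<le>k - i. if j' = j then c * x ^ i * y ^ j else 0)"
      by (intro sum.cong) auto
    then show ?thesis using True assms by simp
  qed simp
  then have "(\<Sum>i'\<le>k. \<Sum>j'\<le>k - i'. (if i' = i \<and> j' = j then c else 0) * x ^ i' * y ^ j')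
      = c * x ^ i * y ^ j" for x y
    using assms by simp
  then show ?thesis
    unfolding bpoly_def by (auto intro!: exI[of _ "\<lambda>i' j'. if i' = i \<and> j' = j then c else 0"])
qed

lemma bpoly_add: "p \<in> bpoly k \<Longrightarrow> q \<in> bpoly k \<Longrightarrow> (\<lambda>x y. p x y + q x y) \<in> bpoly k"
proof -
  assume "p \<in> bpoly k" "q \<in> bpoly k"
  then obtain c d where "\<And>x y. p x y = (\<Sum>i\<le>k. \<Sum>j\<le>k - i. c i j * x ^ i * y ^ j)"
      "\<And>x y. q x y = (\<Sum>i\<le>k. \<Sum>j\<le>k - i. d i j * x ^ i * y ^ j)"
    unfolding bpoly_def by auto
  then show ?thesis
    unfolding bpoly_def
    by (auto intro!: exI[of _ "\<lambda>i j. c i j + d i j"] simp: sum.distrib algebra_simps)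
qed

lemma bpoly_sum:
  assumes "\<And>i. i \<in> A \<Longrightarrow> p i \<in> bpoly k"
  shows "(\<lambda>x y. \<Sum>i\<in>A. p i x y) \<in> bpoly k"
  using assms
proof (induction A rule: infinite_finite_induct)
  case (insert i A)
  then have "p i \<in> bpoly k" "(\<lambda>x y. \<Sum>i\<in>A. p i x y) \<in> bpoly k" by auto
  from bpoly_add[OF this] show ?case
    using insert.hyps by simp
qed (use bpoly_monom[of 0 0 k 0] in auto)

lemma bpoly_mult:
  assumes "p \<in> bpoly m" "q \<in> bpoly n"
  shows "(\<lambda>x y. p x y * q x y) \<in> bpoly (m + n)"
proof -
  obtain c d where c: "\<And>x y. p x y = (\<Sum>i\<le>m. \<Sum>j\<le>m - i. c i j * x ^ i * y ^ j)"
    and d: "\<And>x y. q x y = (\<Sum>i\<le>n. \<Sum>j\<le>n - i. d i j * x ^ i * y ^ j)"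
    using assms unfolding bpoly_def by auto
  have "p x y * q x y = (\<Sum>i\<le>m. \<Sum>i'\<le>n. \<Sum>j\<le>m - i. \<Sum>j'\<le>n - i'.
      (c i j * d i' j') * x ^ (i + i') * y ^ (j + j'))" for x y
    unfolding c d sum_product by (simp add: power_add mult_ac)
  moreover have "(\<lambda>x y. \<Sum>i\<le>m. \<Sum>i'\<le>n. \<Sum>j\<le>m - i. \<Sum>j'\<le>n - i'.
      (c i j * d i' j') * x ^ (i + i') * y ^ (j + j')) \<in> bpoly (m + n)"
    by (intro bpoly_sum bpoly_monom) auto
  ultimately show ?thesis by simp
qed

lemma bpoly_mono: "m \<le> n \<Longrightarrow> bpoly m \<subseteq> bpoly n"
proof
  fix p assume "m \<le> n" "p \<in> bpoly m"
  then obtain c where "\<And>x y. p x y = (\<Sum>i\<le>m. \<Sum>j\<le>m - i. c i j * x ^ i * y ^ j)"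
    unfolding bpoly_def by auto
  then have "p = (\<lambda>x y. \<Sum>i\<le>m. \<Sum>j\<le>m - i. c i j * x ^ i * y ^ j)"
    by (intro ext) simp
  then show "p \<in> bpoly n"
    using \<open>m \<le> n\<close> by (auto intro!: bpoly_sum bpoly_monom)
qed

lemma bpoly_continuous: "p \<in> bpoly k \<Longrightarrow> continuous_on A (\<lambda>(x, y). p x y)"
  unfolding bpoly_def by (auto simp: case_prod_beta intro!: continuous_intros)

lemma bpoly_continuous_slice:
  assumes "p \<in> bpoly k"
  shows "continuous_on A (\<lambda>x. p x y)" "continuous_on A (p x)"
  using assms unfolding bpoly_def by (auto intro!: continuous_intros simp: fun_eq_iff[symmetric])

section \<open>Averages of a polynomial in terms of its coefficients\<close>

definition uniform_moment :: "nat \<Rightarrow> real" where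
  "uniform_moment n = (if even n then 1 / (real n + 1) else 0)"

lemma has_integral_power_sym: "((\<lambda>x. x ^ n) has_integral (2 * uniform_moment n)) {-1..1::real}"
proof -
  have "((\<lambda>x. x ^ n) has_integral (1 ^ Suc n / Suc n - (-1) ^ Suc n / Suc n)) {-1..1::real}"
    by (rule fundamental_theorem_of_calculus)
      (auto intro!: derivative_eq_intros simp: has_real_derivative_iff_has_vector_derivative[symmetric] simp del: power_Suc of_nat_Suc)
  also have "1 ^ Suc n / Suc n - (-1) ^ Suc n / Suc n = 2 * uniform_moment n"
    by (auto simp: uniform_moment_def add.commute)
  finally show ?thesis .
qed

context
  fixes p :: "real \<Rightarrow> real \<Rightarrow> real" and k :: nat and c :: "nat \<Rightarrow> nat \<Rightarrow> real"
  assumes p: "\<And>x y. p x y = (\<Sum>i\<le>k. \<Sum>j\<le>k - i. c i j * x ^ i * y ^ j)"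
begin

lemma integral_slice_y: "((p x) has_integral (\<Sum>i\<le>k. \<Sum>j\<le>k - i. c i j * x ^ i * (2 * uniform_moment j))) {-1..1}"
  unfolding p by (intro has_integral_sum has_integral_mult_right has_integral_power_sym finite_atMost)

lemma integral_slice_x: "((\<lambda>x. p x y) has_integral (\<Sum>i\<le>k. \<Sum>j\<le>k - i. c i j * (2 * uniform_moment i) * y ^ j)) {-1..1}"
  unfolding p by (intro has_integral_sum has_integral_mult_right has_integral_mult_left has_integral_power_sym finite_atMost)

lemma avg_bpoly: "avg p = (\<Sum>i\<le>k. \<Sum>j\<le>k - i. c i j * (uniform_moment i * uniform_moment j))"
proof -
  have "p \<in> bpoly k" unfolding bpoly_def using p by blast
  then have "continuous_on (cbox (-1, -1) (1, 1)) (\<lambda>(x, y). p x y)"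
    by (rule bpoly_continuous)
  from integral_prod_continuous[OF this]
  have "integral ({-1..1} \<times> {-1..1}) (\<lambda>(x, y). p x y) = integral {-1..1} (\<lambda>x. integral {-1..1} (p x))"
    by (simp add: cbox_Pair_eq)
  also have "\<dots> = integral {-1..1} (\<lambda>x. \<Sum>i\<le>k. \<Sum>j\<le>k - i. c i j * x ^ i * (2 * uniform_moment j))"
    by (simp add: integral_unique[OF integral_slice_y])
  also have "\<dots> = (\<Sum>i\<le>k. \<Sum>j\<le>k - i. c i j * (2 * uniform_moment i) * (2 * uniform_moment j))"
    by (intro integral_unique has_integral_sum has_integral_mult_right has_integral_mult_left
        has_integral_power_sym finite_atMost)
  also have "\<dots> = 4 * (\<Sum>i\<le>k. \<Sum>j\<le>k - i. c i j * (uniform_moment i * uniform_moment j))"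
    by (simp add: sum_distrib_left mult_ac)
  finally show ?thesis by (simp add: avg_def)
qed

lemma avg_x_bpoly: "avg_x p = (\<Sum>i\<le>k. \<Sum>j\<le>k - i. c i j * (of_bool (even i) * uniform_moment j))"
proof -
  have "integral {-1..1} (\<lambda>y. p (-1) y + p 1 y)
      = (\<Sum>i\<le>k. \<Sum>j\<le>k - i. c i j * (-1) ^ i * (2 * uniform_moment j))
      + (\<Sum>i\<le>k. \<Sum>j\<le>k - i. c i j * 1 ^ i * (2 * uniform_moment j))"
    by (intro integral_unique has_integral_add integral_slice_y)
  also have "\<dots> = 4 * (\<Sum>i\<le>k. \<Sum>j\<le>k - i. c i j * (of_bool (even i) * uniform_moment j))"
    unfolding sum.distrib[symmetric] sum_distrib_left by (intro sum.cong refl) auto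
  finally show ?thesis by (simp add: avg_x_def)
qed

lemma avg_y_bpoly: "avg_y p = (\<Sum>i\<le>k. \<Sum>j\<le>k - i. c i j * (uniform_moment i * of_bool (even j)))"
proof -
  have "integral {-1..1} (\<lambda>x. p x (-1) + p x 1)
      = (\<Sum>i\<le>k. \<Sum>j\<le>k - i. c i j * (2 * uniform_moment i) * (-1) ^ j)
      + (\<Sum>i\<le>k. \<Sum>j\<le>k - i. c i j * (2 * uniform_moment i) * 1 ^ j)"
    by (intro integral_unique has_integral_add integral_slice_x)
  also have "\<dots> = 4 * (\<Sum>i\<le>k. \<Sum>j\<le>k - i. c i j * (uniform_moment i * of_bool (even j)))"
    unfolding sum.distrib[symmetric] sum_distrib_left by (intro sum.cong refl) auto
  finally show ?thesis by (simp add: avg_y_def)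
qed

lemma sym_avg_bpoly:
  "sym_avg p a b = (\<Sum>i\<le>k. \<Sum>j\<le>k - i. c i j * of_bool (even i \<and> even j) * (a ^ i * b ^ j))"
  unfolding sym_avg_def p sum.distrib[symmetric] sum_distrib_left
  by (intro sum.cong refl) (auto simp: power_minus_odd)

lemma nodes_sum_bpoly:
  "(\<Sum>(\<omega>, x, y)\<leftarrow>nodes. \<omega> * sym_avg p x y)
    = (\<Sum>i\<le>k. \<Sum>j\<le>k - i. c i j * (of_bool (even i \<and> even j) * (\<Sum>(\<omega>, x, y)\<leftarrow>nodes. \<omega> * (x ^ i * y ^ j))))"
  by (induction nodes) (auto simp: sym_avg_bpoly sum_distrib_left sum.distrib[symmetric] algebra_simps intro!: sum.cong)

end

text \<open>All functionals involved are linear and vanish on monomials with an odd exponent, so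
  only even exponents have to be matched.\<close>

lemma feasible_from_moments:
  assumes "w > 0" and "\<forall>(\<omega>, x, y) \<in> set nodes. \<omega> > 0 \<and> x \<in> {0..1} \<and> y \<in> {0..1}"
    and mom: "\<And>i j. even i \<Longrightarrow> even j \<Longrightarrow> i + j \<le> k \<Longrightarrow>
      1 / ((real i + 1) * (real j + 1)) - w * ((1 + \<theta>) / (1 + real j) + (1 - \<theta>) / (1 + real i))
      = (\<Sum>(\<omega>, x, y)\<leftarrow>nodes. \<omega> * (x ^ i * y ^ j))"
  shows "feasible_symmetric_CAD \<theta> k w nodes"
  unfolding feasible_symmetric_CAD_def
proof (intro conjI ballI)
  fix p assume "p \<in> bpoly k"
  then obtain c where p: "\<And>x y. p x y = (\<Sum>i\<le>k. \<Sum>j\<le>k - i. c i j * x ^ i * y ^ j)"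
    unfolding bpoly_def by auto
  have "w * bdry_avg \<theta> p + (\<Sum>(\<omega>, x, y)\<leftarrow>nodes. \<omega> * sym_avg p x y)
    = (\<Sum>i\<le>k. \<Sum>j\<le>k - i. c i j * (w * ((1 + \<theta>) * (of_bool (even i) * uniform_moment j)
        + (1 - \<theta>) * (uniform_moment i * of_bool (even j)))
        + of_bool (even i \<and> even j) * (\<Sum>(\<omega>, x, y)\<leftarrow>nodes. \<omega> * (x ^ i * y ^ j))))"
    unfolding bdry_avg_def avg_x_bpoly[OF p] avg_y_bpoly[OF p] nodes_sum_bpoly[OF p]
    unfolding sum_distrib_left sum.distrib[symmetric]
    by (intro sum.cong refl) (simp add: algebra_simps)
  also have "\<dots> = avg p"
    unfolding avg_bpoly[OF p]
  proof (intro sum.cong refl)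
    fix i j assume ij: "i \<in> {..k}" "j \<in> {..k - i}"
    show "c i j * (w * ((1 + \<theta>) * (of_bool (even i) * uniform_moment j)
        + (1 - \<theta>) * (uniform_moment i * of_bool (even j)))
        + of_bool (even i \<and> even j) * (\<Sum>(\<omega>, x, y)\<leftarrow>nodes. \<omega> * (x ^ i * y ^ j)))
        = c i j * (uniform_moment i * uniform_moment j)"
    proof (cases "even i \<and> even j")
      case True
      moreover have "i + j \<le> k" using ij by auto
      ultimately show ?thesis
        using mom[of i j, symmetric] by (simp add: uniform_moment_def add.commute)
    qed (auto simp: uniform_moment_def)
  qed
  finally show "avg p = w * bdry_avg \<theta> p + (\<Sum>(\<omega>, x, y)\<leftarrow>nodes. \<omega> * sym_avg p x y)" by simp
qed (use assms in auto)

section \<open>Weak duality and optimality\<close>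

lemma avg_square_pos:
  assumes "q \<in> bpoly m" and "x \<in> {-1..1}" "y \<in> {-1..1}" "q x y \<noteq> 0"
  shows "avg (\<lambda>x y. (q x y)\<^sup>2) > 0"
proof -
  let ?f = "\<lambda>(x, y). (q x y)\<^sup>2"
  have q2: "(\<lambda>x y. (q x y)\<^sup>2) \<in> bpoly (m + m)"
    using bpoly_mult[OF assms(1) assms(1)] by (simp add: power2_eq_square)
  have cont: "continuous_on (cbox (-1, -1) (1, 1)) ?f"
    using q2 by (rule bpoly_continuous)
  have nn: "0 \<le> integral (cbox (-1, -1) (1, 1)) ?f"
    by (intro integral_nonneg integrable_continuous cont) auto
  moreover have "integral (cbox (-1, -1) (1, 1)) ?f \<noteq> 0"
  proof
    assume "integral (cbox (-1, -1) (1, 1)) ?f = 0"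
    then have 0: "(?f has_integral 0) (cbox (-1, -1) (1, 1))"
      using integrable_integral[OF integrable_continuous[OF cont]] by simp
    have "?f (x, y) = 0"
      by (rule has_integral_0_cbox_imp_0[OF cont _ 0]) (use assms in \<open>auto simp: box_ne_empty Basis_prod_def cbox_Pair_eq\<close>)
    then show False using assms by simp
  qed
  ultimately show ?thesis
    by (simp add: avg_def cbox_Pair_eq)
qed

lemma bdry_avg_nonneg:
  assumes "p \<in> bpoly_nonneg k" and "\<theta> \<in> {-1..1}"
  shows "bdry_avg \<theta> p \<ge> 0"
proof -
  have p: "p \<in> bpoly k" and nn: "\<And>x y. x \<in> {-1..1} \<Longrightarrow> y \<in> {-1..1} \<Longrightarrow> 0 \<le> p x y"
    using assms(1) by (auto simp: bpoly_nonneg_def)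
  note cont = bpoly_continuous_slice[OF p]
  have "avg_x p \<ge> 0"
    unfolding avg_x_def
    by (intro mult_nonneg_nonneg integral_nonneg integrable_continuous_real continuous_on_add cont)
      (auto intro!: add_nonneg_nonneg nn)
  moreover have "avg_y p \<ge> 0"
    unfolding avg_y_def
    by (intro mult_nonneg_nonneg integral_nonneg integrable_continuous_real continuous_on_add cont)
      (auto intro!: add_nonneg_nonneg nn)
  ultimately show ?thesis
    using assms(2) by (simp add: bdry_avg_def)
qed

lemma feasible_lower_bound:
  assumes "feasible_symmetric_CAD \<theta> k w nodes" and "p \<in> bpoly_nonneg k"
  shows "w * bdry_avg \<theta> p \<le> avg p"
proof -
  have "0 \<le> (\<Sum>(\<omega>, x, y)\<leftarrow>nodes. \<omega> * sym_avg p x y)"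
  proof (rule sum_list_nonneg)
    fix z assume "z \<in> set (map (\<lambda>(\<omega>, x, y). \<omega> * sym_avg p x y) nodes)"
    then obtain \<omega> x y where n: "(\<omega>, x, y) \<in> set nodes" and z: "z = \<omega> * sym_avg p x y"
      by auto
    have "\<omega> > 0" "x \<in> {0..1}" "y \<in> {0..1}"
      using assms(1) n by (auto simp: feasible_symmetric_CAD_def)
    moreover from this have "0 \<le> sym_avg p x y"
      using assms(2) by (auto simp: sym_avg_def bpoly_nonneg_def intro!: add_nonneg_nonneg)
    ultimately show "0 \<le> z" by (simp add: z)
  qed
  moreover have "p \<in> bpoly k" using assms(2) by (simp add: bpoly_nonneg_def)
  ultimately show ?thesis
    using assms(1) by (simp add: feasible_symmetric_CAD_def)
qed

text \<open>A nonzero square \<open>q\<^sup>2\<close> vanishing at all nodes certifies optimality, because the boundary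
  weight of a CAD is bounded by \<open>phi \<theta> (q\<^sup>2)\<close>, with equality if the nodes do not contribute.\<close>

lemma optimal_CAD:
  assumes \<theta>: "\<theta> \<in> {-1..1}"
    and feas: "feasible_symmetric_CAD \<theta> k w nodes"
    and q: "q \<in> bpoly m" and mk: "m + m \<le> k"
    and nz: "x0 \<in> {-1..1}" "y0 \<in> {-1..1}" "q x0 y0 \<noteq> 0"
    and van: "\<forall>(\<omega>, x, y) \<in> set nodes. sym_avg (\<lambda>x y. (q x y)\<^sup>2) x y = 0"
  shows "symmetric_OCAD \<theta> k w nodes"
    and "max_bdry_weight \<theta> k = w"
    and "phi_star \<theta> (bpoly_nonneg k) = ereal w"
    and "phi_star \<theta> (bpoly_squares m) = ereal w"
    and "critical_positive_poly \<theta> k (\<lambda>x y. (q x y)\<^sup>2)"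
proof -
  let ?p = "\<lambda>x y. (q x y)\<^sup>2"
  have sq: "(\<lambda>x y. (r x y)\<^sup>2) \<in> bpoly_nonneg k" if "r \<in> bpoly m" for r
    using bpoly_mult[OF that that] bpoly_mono[OF mk] by (auto simp: bpoly_nonneg_def power2_eq_square)
  have w: "w > 0" using feas by (simp add: feasible_symmetric_CAD_def)
  have p: "?p \<in> bpoly_nonneg k" by (rule sq[OF q])
  have "map (\<lambda>(\<omega>, x, y). \<omega> * sym_avg ?p x y) nodes = map (\<lambda>_. 0) nodes"
    using van by auto
  then have "(\<Sum>(\<omega>, x, y)\<leftarrow>nodes. \<omega> * sym_avg ?p x y) = 0"
    by (simp only: sum_list_0)
  then have eq: "avg ?p = w * bdry_avg \<theta> ?p"
    using feas p by (auto simp: feasible_symmetric_CAD_def bpoly_nonneg_def)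
  \<comment> \<open>As w > 0, the identity \<open>eq\<close> transfers positivity from the area
    average to the boundary average.\<close>
  have bp: "bdry_avg \<theta> ?p > 0"
    using avg_square_pos[OF q nz] w by (simp add: eq zero_less_mult_iff)
  have le: "w' \<le> w" if "feasible_symmetric_CAD \<theta> k w' nodes'" for w' nodes'
    using feasible_lower_bound[OF that p] bp by (simp add: eq)
  show "symmetric_OCAD \<theta> k w nodes"
    using feas le by (auto simp: symmetric_OCAD_def)
  show "max_bdry_weight \<theta> k = w"
    unfolding max_bdry_weight_def using feas le by (intro Greatest_equality) auto
  have phi_q: "phi \<theta> ?p = ereal w"
    using bp by (simp add: phi_def eq)
  have lower: "ereal w \<le> phi \<theta> r" if "r \<in> bpoly_nonneg k" for r
    using feasible_lower_bound[OF feas that] bdry_avg_nonneg[OF that \<theta>]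
    by (auto simp: phi_def pos_le_divide_eq)
  have "phi_star \<theta> (bpoly_nonneg k) \<le> phi \<theta> ?p"
    unfolding phi_star_def using p by (rule INF_lower)
  then show star: "phi_star \<theta> (bpoly_nonneg k) = ereal w"
    unfolding phi_q using lower by (intro antisym) (auto simp: phi_star_def intro: INF_greatest)
  have "?p \<in> bpoly_squares m" using q by (auto simp: bpoly_squares_def)
  then have "phi_star \<theta> (bpoly_squares m) \<le> phi \<theta> ?p"
    unfolding phi_star_def by (rule INF_lower)
  moreover have "bpoly_squares m \<subseteq> bpoly_nonneg k"
    using sq by (auto simp: bpoly_squares_def)
  ultimately show "phi_star \<theta> (bpoly_squares m) = ereal w"
    unfolding phi_q using lower by (intro antisym) (auto simp: phi_star_def intro: INF_greatest)
  show "critical_positive_poly \<theta> k ?p"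
    unfolding critical_positive_poly_def star phi_q using p nz(3) by (auto simp: fun_eq_iff)
qed

text \<open>Feasibility passes from degree 7 to degree 6 by inclusion of the polynomial spaces, and
  the square of a cubic is admissible for both, so one certificate serves both degrees.\<close>

lemma optimal_CAD_6_7:
  assumes \<theta>: "\<theta> \<in> {-1..1}"
    and feas: "feasible_symmetric_CAD \<theta> 7 w nodes"
    and q: "q \<in> bpoly 3"
    and nz: "x0 \<in> {-1..1}" "y0 \<in> {-1..1}" "q x0 y0 \<noteq> 0"
    and van: "\<forall>(\<omega>, x, y) \<in> set nodes. sym_avg (\<lambda>x y. (q x y)\<^sup>2) x y = 0"
  shows "\<forall>k\<in>{6, 7}. symmetric_OCAD \<theta> k w nodes"
    and "\<forall>k\<in>{6, 7}. max_bdry_weight \<theta> k = w \<and>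
        ereal (max_bdry_weight \<theta> k) = phi_star \<theta> (bpoly_nonneg k) \<and>
        phi_star \<theta> (bpoly_nonneg k) = phi_star \<theta> (bpoly_squares 3) \<and>
        (\<exists>q\<in>bpoly 3. q \<noteq> (\<lambda>x y. 0) \<and> critical_positive_poly \<theta> k (\<lambda>x y. (q x y)\<^sup>2))"
proof -
  have "feasible_symmetric_CAD \<theta> k w nodes \<and> 3 + 3 \<le> k" if "k \<in> {6, 7}" for k :: nat
    using feas bpoly_mono[of 6 7] that by (auto simp: feasible_symmetric_CAD_def)
  note * = optimal_CAD[OF \<theta> conjunct1[OF this] q conjunct2[OF this] nz van]
  show "\<forall>k\<in>{6, 7}. symmetric_OCAD \<theta> k w nodes"
  proof
    fix k :: nat assume k: "k \<in> {6, 7}"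
    show "symmetric_OCAD \<theta> k w nodes" by (rule *(1)[OF k k])
  qed
  have "q \<noteq> (\<lambda>x y. 0)" using nz(3) by auto
  have "max_bdry_weight \<theta> k = w \<and>
        ereal (max_bdry_weight \<theta> k) = phi_star \<theta> (bpoly_nonneg k) \<and>
        phi_star \<theta> (bpoly_nonneg k) = phi_star \<theta> (bpoly_squares 3) \<and>
        (\<exists>q\<in>bpoly 3. q \<noteq> (\<lambda>x y. 0) \<and> critical_positive_poly \<theta> k (\<lambda>x y. (q x y)\<^sup>2))"
    if "k \<in> {6, 7}" for k
    unfolding *(2)[OF that that] *(3)[OF that that] *(4)[OF that that]
    using *(5)[OF that that] q \<open>q \<noteq> (\<lambda>x y. 0)\<close> by auto
  then show "\<forall>k\<in>{6, 7}. max_bdry_weight \<theta> k = w \<and>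
        ereal (max_bdry_weight \<theta> k) = phi_star \<theta> (bpoly_nonneg k) \<and>
        phi_star \<theta> (bpoly_nonneg k) = phi_star \<theta> (bpoly_squares 3) \<and>
        (\<exists>q\<in>bpoly 3. q \<noteq> (\<lambda>x y. 0) \<and> critical_positive_poly \<theta> k (\<lambda>x y. (q x y)\<^sup>2))"
    by blast
qed

subsection \<open>The cubature formula for each sign of \<open>\<theta>\<close>\<close>

context quartic_root
begin

text \<open>The factor w stands for the scaling between \<open>mom\<close> and the normalised
  moments. By \<open>rank\<close> the radicands with n06 contain the square K^2 / B, so the roots
  become rational in s.\<close>

lemma sqrt_forms:
  assumes "w > 0"
  shows "sqrt ((1 - beta) * (w\<^sup>2 * B) / beta) = w * s"
    and "sqrt ((1 - beta) * (w\<^sup>2 * (n02 * n06 - n04\<^sup>2)) / beta) = w * (s * K / B)"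
    and "sqrt (beta * (w\<^sup>2 * B) / (1 - beta)) = w * (B / s)"
    and "sqrt (beta * (w\<^sup>2 * (n02 * n06 - n04\<^sup>2)) / (1 - beta)) = w * (K / s)"
proof -
  have B3: "n02 * n06 - n04\<^sup>2 = K\<^sup>2 / B"
    using rank BG_pos by (simp add: field_simps)
  have D: "B + s\<^sup>2 > 0" using BG_pos by (simp add: add_pos_nonneg)
  note pos = assms s_pos BG_pos(1) K_nonneg D
  show "sqrt ((1 - beta) * (w\<^sup>2 * B) / beta) = w * s"
    unfolding beta_s(2) unfolding beta_s(1) using pos
    by (intro real_sqrt_unique) (auto simp: power_mult_distrib)
  show "sqrt ((1 - beta) * (w\<^sup>2 * (n02 * n06 - n04\<^sup>2)) / beta) = w * (s * K / B)"
    unfolding B3 unfolding beta_s(2) unfolding beta_s(1) using pos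
    by (intro real_sqrt_unique) (auto simp: power_mult_distrib power_divide power2_eq_square)
  show "sqrt (beta * (w\<^sup>2 * B) / (1 - beta)) = w * (B / s)"
    unfolding beta_s(2) unfolding beta_s(1) using pos
    by (intro real_sqrt_unique) (auto simp: power_mult_distrib power_divide power2_eq_square)
  show "sqrt (beta * (w\<^sup>2 * (n02 * n06 - n04\<^sup>2)) / (1 - beta)) = w * (K / s)"
    unfolding B3 unfolding beta_s(2) unfolding beta_s(1) using pos
    by (intro real_sqrt_unique) (auto simp: power_mult_distrib power_divide power2_eq_square)
qed

lemma W_Y: "W1 * Y1 = beta * n02" "W2 * Y2 = (1 - beta) * n02"
  using nodes12_range by (simp_all add: W1_def W2_def)

text \<open>Let \<xi> take the values -s and B / s with probabilities beta and 1 - beta: its mean is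
  0 and its variance B. Then n02 X = n22 + \<xi> and n02 Y = n04 - (K / B) \<xi>, which yields all
  moments of order at most two under the weights W Y. That the variance K^2 / B of n02 Y fits n06 is
  \<open>rank\<close>.\<close>

lemma y_moments:
  "W1 * Y1 + W2 * Y2 = n02"
  "W1 * Y1 * X1 + W2 * Y2 * X2 = n22"
  "W1 * Y1 * X1\<^sup>2 + W2 * Y2 * X2\<^sup>2 = n42"
  "W1 * Y1 * Y1 + W2 * Y2 * Y2 = n04"
  "W1 * Y1 * (X1 * Y1) + W2 * Y2 * (X2 * Y2) = n24"
  "W1 * Y1 * Y1\<^sup>2 + W2 * Y2 * Y2\<^sup>2 = n06"
proof -
  define i where "i = 1 / s"
  define c where "c = 1 - beta"
  define j where "j = 1 / B"
  have si: "s * i = 1" and Bj: "B * j = 1" using s_pos BG_pos by (auto simp: i_def j_def)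
  have bc: "beta + c = 1" "beta * s\<^sup>2 = c * B"
  proof -
    show "beta + c = 1" by (simp add: c_def)
    have "B + s\<^sup>2 \<noteq> 0" using BG_pos(1) zero_le_power2[of s] by linarith
    then show "beta * s\<^sup>2 = c * B" unfolding c_def beta_s(2) unfolding beta_s(1) by simp
  qed
  have X: "n02 * X1 = n22 - s" "n02 * X2 = n22 + B * i"
    "n02 * Y1 = n04 + s * K * j" "n02 * Y2 = n04 - K * i"
    using n_pos by (simp_all add: X1_def X2_def Y1_def Y2_def i_def j_def)
  have n0: "n02 \<noteq> 0" using n_pos by simp
  note W = W_Y(1) W_Y(2)[folded c_def]
  have e: "beta * s = c * (B * i)" using bc si by algebra
  show "W1 * Y1 + W2 * Y2 = n02" unfolding W using bc by algebra
  have "W1 * Y1 * X1 + W2 * Y2 * X2 = beta * (n02 * X1) + c * (n02 * X2)"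
    unfolding W by algebra
  also have "\<dots> = n22" unfolding X using bc e by algebra
  finally show "W1 * Y1 * X1 + W2 * Y2 * X2 = n22" .
  have "n02 * (W1 * Y1 * X1\<^sup>2 + W2 * Y2 * X2\<^sup>2) = beta * (n02 * X1)\<^sup>2 + c * (n02 * X2)\<^sup>2"
    unfolding W by algebra
  also have "\<dots> = n22\<^sup>2 + B" unfolding X using bc si by algebra
  also have "\<dots> = n02 * n42" by (simp add: B_def)
  finally show "W1 * Y1 * X1\<^sup>2 + W2 * Y2 * X2\<^sup>2 = n42" using n0 by simp
  have "W1 * Y1 * Y1 + W2 * Y2 * Y2 = beta * (n02 * Y1) + c * (n02 * Y2)"
    unfolding W by algebra
  also have "\<dots> = n04" unfolding X using bc e Bj by algebra
  finally show "W1 * Y1 * Y1 + W2 * Y2 * Y2 = n04" .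
  have "n02 * (W1 * Y1 * (X1 * Y1) + W2 * Y2 * (X2 * Y2))
      = beta * (n02 * X1) * (n02 * Y1) + c * (n02 * X2) * (n02 * Y2)"
    unfolding W by algebra
  also have "\<dots> = n22 * n04 - K" unfolding X using bc si Bj by algebra
  also have "\<dots> = n02 * n24" by (simp add: K_def)
  finally show "W1 * Y1 * (X1 * Y1) + W2 * Y2 * (X2 * Y2) = n24" using n0 by simp
  have "n02 * (W1 * Y1 * Y1\<^sup>2 + W2 * Y2 * Y2\<^sup>2) = beta * (n02 * Y1)\<^sup>2 + c * (n02 * Y2)\<^sup>2"
    unfolding W by algebra
  also have "\<dots> = n04\<^sup>2 + K\<^sup>2 * j" unfolding X using bc si Bj by algebra
  also have "\<dots> = n02 * n06" unfolding rank using Bj by algebra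
  finally show "W1 * Y1 * Y1\<^sup>2 + W2 * Y2 * Y2\<^sup>2 = n06" using n0 by simp
qed

lemma nodes12_conic: "G - K * X1 - B * Y1 = 0" "G - K * X2 - B * Y2 = 0"
proof -
  show "G - K * X1 - B * Y1 = 0" using BG_pos by (simp add: Y1_eq u_def)
  have "G * s - K * Q - B * v = 0"
    unfolding s_X1 Q_def v_def G_def K_def B_def by algebra
  then have "(G * s - K * Q - B * v) / s = 0" by simp
  then show "G - K * X2 - B * Y2 = 0"
    using s_pos by (simp add: X2_eq Y2_eq diff_divide_distrib)
qed

text \<open>The value of G - K x^2 - B y^2 at (0, 1/2), a witness that the critical polynomial is
  not zero.\<close>

lemma conic_nonzero: "G - B / 4 > 0"
proof -
  have "G - B / 4 = 4900 + 20580 * t + 8820 * t\<^sup>2 + (2254 + 4998 * t) * h + 343 * h\<^sup>2"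
    unfolding G_eq B_eq by (simp add: power2_eq_square algebra_simps)
  then show ?thesis using t h by (simp add: add_pos_nonneg)
qed

end

section \<open>The case \<theta> in [-1,0]\<close>

locale nodes_negative = quartic_root +
  fixes \<theta> :: real
  assumes \<theta>: "\<theta> = - t" and wbar_inv_eq: "wbar_inv \<theta> = 11 + 9 * t + h"
begin

definition "\<kappa> = wbar \<theta> / 315"

lemma wbar_inv_pos: "wbar_inv \<theta> > 0"
  unfolding wbar_inv_eq using h t by simp

lemma wbar_pos: "wbar \<theta> > 0" and kappa_pos: "\<kappa> > 0"
  using wbar_inv_pos by (simp_all add: wbar_def \<kappa>_def)

lemma mom_eq:
  "mom \<theta> 0 0 = \<kappa> * n00" "mom \<theta> 2 0 = \<kappa> * n20" "mom \<theta> 4 0 = \<kappa> * n40" "mom \<theta> 6 0 = \<kappa> * n60"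
  "mom \<theta> 0 2 = \<kappa> * n02" "mom \<theta> 2 2 = \<kappa> * n22" "mom \<theta> 4 2 = \<kappa> * n42"
  "mom \<theta> 0 4 = \<kappa> * n04" "mom \<theta> 2 4 = \<kappa> * n24" "mom \<theta> 0 6 = \<kappa> * n06"
  unfolding mom_def n_defs \<kappa>_def wbar_def wbar_inv_eq unfolding \<theta>
  using wbar_inv_pos[unfolded wbar_inv_eq] by (simp_all add: field_simps)

lemma beta_eqs:
  "beta1N \<theta> = beta" "beta2N \<theta> = \<kappa>\<^sup>2 * B" "beta3N \<theta> = \<kappa>\<^sup>2 * (n02 * n06 - n04\<^sup>2)"
proof -
  have "(\<kappa> * n22)\<^sup>2 / ((\<kappa> * n42) * (\<kappa> * n02)) = n22\<^sup>2 / (n42 * n02)"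
    using kappa_pos by (simp add: power2_eq_square)
  moreover have "\<theta>\<^sup>2 = t\<^sup>2" by (simp add: \<theta>)
  ultimately show "beta1N \<theta> = beta"
    unfolding beta1N_def beta_def mom_eq by simp
  show "beta2N \<theta> = \<kappa>\<^sup>2 * B" "beta3N \<theta> = \<kappa>\<^sup>2 * (n02 * n06 - n04\<^sup>2)"
    unfolding beta2N_def beta3N_def mom_eq B_def by algebra+
qed

lemma node_squares: "X1N \<theta> = X1" "Y1N \<theta> = Y1" "X2N \<theta> = X2" "Y2N \<theta> = Y2"
proof -
  have cancel: "(\<kappa> * x - \<kappa> * y) / (\<kappa> * z) = (x - y) / z" "(\<kappa> * x + \<kappa> * y) / (\<kappa> * z) = (x + y) / z"
    for x y z
    using kappa_pos by (simp_all flip: right_diff_distrib distrib_left)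
  show "X1N \<theta> = X1" "Y1N \<theta> = Y1" "X2N \<theta> = X2" "Y2N \<theta> = Y2"
    unfolding X1N_def Y1N_def X2N_def Y2N_def beta_eqs mom_eq sqrt_forms[OF kappa_pos] cancel
      X1_def Y1_def X2_def Y2_def
    by (rule refl)+
qed

lemma nodes_sq:
  "(x1N \<theta>)\<^sup>2 = X1" "(y1N \<theta>)\<^sup>2 = Y1" "(x2N \<theta>)\<^sup>2 = X2" "(y2N \<theta>)\<^sup>2 = Y2"
  using nodes12_range by (simp_all add: x1N_def y1N_def x2N_def y2N_def node_squares)

lemma nodes_range: "x1N \<theta> \<in> {0..1}" "y1N \<theta> \<in> {0..1}" "x2N \<theta> \<in> {0..1}" "y2N \<theta> \<in> {0..1}"
  using nodes12_range by (simp_all add: x1N_def y1N_def x2N_def y2N_def node_squares)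

lemma even_powers: "x ^ 4 = (x\<^sup>2)\<^sup>2" "x ^ 6 = (x\<^sup>2) ^ 3" for x :: real
  by (simp_all flip: power_mult)

lemma omega12: "omega1N \<theta> = \<kappa> * W1" "omega2N \<theta> = \<kappa> * W2"
  unfolding omega1N_def omega2N_def nodes_sq beta_eqs mom_eq W1_def W2_def by simp_all

lemma res_eq:
  "resN \<theta> 0 = \<kappa> * r0" "resN \<theta> 2 = \<kappa> * r2" "resN \<theta> 4 = \<kappa> * r4" "resN \<theta> 6 = \<kappa> * r6"
  unfolding resN_def even_powers nodes_sq omega12 mom_eq r0_def r2_def r4_def r6_def
  by (simp_all add: algebra_simps)

lemma nodes12: "nodes12N_defined \<theta>"
  unfolding nodes12N_defined_def beta_eqs mom_eq node_squares
  using kappa_pos n_pos beta01 nodes12_range BG_pos rank zero_le_power2[of K]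
  by (auto simp: zero_le_mult_iff intro!: divide_nonneg_nonneg mult_nonneg_nonneg)

lemma residual_quadrature:
  "nodes34_defined (resN \<theta>)" "omega3 (resN \<theta>) > 0" "omega4 (resN \<theta>) > 0"
  "Z3 (resN \<theta>) \<in> {0..1}" "Z4 (resN \<theta>) \<in> {0..1}"
  "omega3 (resN \<theta>) + omega4 (resN \<theta>) = resN \<theta> 0"
  "omega3 (resN \<theta>) * Z3 (resN \<theta>) + omega4 (resN \<theta>) * Z4 (resN \<theta>) = resN \<theta> 2"
  "omega3 (resN \<theta>) * (Z3 (resN \<theta>))\<^sup>2 + omega4 (resN \<theta>) * (Z4 (resN \<theta>))\<^sup>2 = resN \<theta> 4"
  "omega3 (resN \<theta>) * Z3 (resN \<theta>) ^ 3 + omega4 (resN \<theta>) * Z4 (resN \<theta>) ^ 3 = resN \<theta> 6"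
proof -
  have k2: "\<kappa>\<^sup>2 > 0" using kappa_pos by simp
  have a: "resN \<theta> 2 < resN \<theta> 0" "0 < resN \<theta> 2"
    using residual_bounds(1,2) kappa_pos by (simp_all add: res_eq)
  have b: "(resN \<theta> 2)\<^sup>2 < resN \<theta> 4 * resN \<theta> 0"
    using mult_strict_left_mono[OF residual_bounds(3) k2]
    by (simp add: res_eq power_mult_distrib) (simp add: power2_eq_square mult_ac)
  have c: "(resN \<theta> 4)\<^sup>2 \<le> resN \<theta> 2 * resN \<theta> 6"
    using mult_left_mono[OF residual_bounds(4) less_imp_le[OF k2]]
    by (simp add: res_eq power_mult_distrib) (simp add: power2_eq_square mult_ac)
  have d: "(resN \<theta> 2 - resN \<theta> 4)\<^sup>2 \<le> (resN \<theta> 0 - resN \<theta> 2) * (resN \<theta> 4 - resN \<theta> 6)"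
    using mult_left_mono[OF residual_bounds(5) less_imp_le[OF k2]]
    by (simp add: res_eq power2_eq_square algebra_simps)
  note q = two_point_quadrature[of "resN \<theta>", OF a b c d]
  show "nodes34_defined (resN \<theta>)" "omega3 (resN \<theta>) > 0" "omega4 (resN \<theta>) > 0"
    "Z3 (resN \<theta>) \<in> {0..1}" "Z4 (resN \<theta>) \<in> {0..1}"
    "omega3 (resN \<theta>) + omega4 (resN \<theta>) = resN \<theta> 0"
    "omega3 (resN \<theta>) * Z3 (resN \<theta>) + omega4 (resN \<theta>) * Z4 (resN \<theta>) = resN \<theta> 2"
    "omega3 (resN \<theta>) * (Z3 (resN \<theta>))\<^sup>2 + omega4 (resN \<theta>) * (Z4 (resN \<theta>))\<^sup>2 = resN \<theta> 4"
    "omega3 (resN \<theta>) * Z3 (resN \<theta>) ^ 3 + omega4 (resN \<theta>) * Z4 (resN \<theta>) ^ 3 = resN \<theta> 6"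
    using q by blast+
qed

lemma z_sq: "(z3 (resN \<theta>))\<^sup>2 = Z3 (resN \<theta>)" "(z4 (resN \<theta>))\<^sup>2 = Z4 (resN \<theta>)"
  using residual_quadrature(4,5) by (simp_all add: z3_def z4_def)

lemma nodes_valid: "\<forall>(\<omega>, x, y) \<in> set (nodesN \<theta>). \<omega> > 0 \<and> x \<in> {0..1} \<and> y \<in> {0..1}"
  using nodes_range residual_quadrature(2-5) kappa_pos W_pos
  by (auto simp: nodesN_def omega12 z3_def z4_def)

lemma moments:
  assumes "even i" "even j" "i + j \<le> 7"
  shows "mom \<theta> i j = (\<Sum>(\<omega>, x, y)\<leftarrow>nodesN \<theta>. \<omega> * (x ^ i * y ^ j))"
proof -
  \<comment> \<open>Even exponents have an even sum, so the bound 7 amounts to 6 and ten cases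
    remain.\<close>
  have "(i, j) \<in> {(0, 0), (2, 0), (4, 0), (6, 0), (0, 2), (2, 2), (4, 2), (0, 4), (2, 4), (0, 6)}"
  proof -
    have "i = 0 \<or> i = 2 \<or> i = 4 \<or> i = 6" "j = 0 \<or> j = 2 \<or> j = 4 \<or> j = 6"
      using assms by presburger+
    then show ?thesis by (elim disjE) (use assms(3) in simp_all)
  qed
  moreover define S where "S i j = omega1N \<theta> * (x1N \<theta> ^ i * y1N \<theta> ^ j)
    + omega2N \<theta> * (x2N \<theta> ^ i * y2N \<theta> ^ j)
    + omega3 (resN \<theta>) * (z3 (resN \<theta>) ^ i * 0 ^ j) + omega4 (resN \<theta>) * (z4 (resN \<theta>) ^ i * 0 ^ j)" for i j
  have x: "mom \<theta> r 0 = omega1N \<theta> * x1N \<theta> ^ r + omega2N \<theta> * x2N \<theta> ^ r + resN \<theta> r" for r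
    by (simp add: resN_def)
  \<comment> \<open>For j = 0 nodes 3 and 4 supply the residual moments, with 0 ^ 0 = 1. For j \<ge>
    2 they lie on y = 0 and contribute nothing, so nodes 1 and 2 must match alone.\<close>
  have "mom \<theta> 0 0 = S 0 0" "mom \<theta> 2 0 = S 2 0" "mom \<theta> 4 0 = S 4 0" "mom \<theta> 6 0 = S 6 0"
    unfolding S_def x residual_quadrature(6-9)[symmetric] even_powers z_sq by simp_all
  moreover have "mom \<theta> 0 2 = S 0 2" "mom \<theta> 2 2 = S 2 2" "mom \<theta> 4 2 = S 4 2"
    "mom \<theta> 0 4 = S 0 4" "mom \<theta> 2 4 = S 2 4" "mom \<theta> 0 6 = S 0 6"
    unfolding S_def mom_eq even_powers nodes_sq omega12 y_moments[symmetric]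
    by (simp_all add: power2_eq_square power3_eq_cube algebra_simps)
  ultimately have "mom \<theta> i j = S i j" by auto
  then show ?thesis by (simp add: S_def nodesN_def)
qed

lemma sym_avg_conic_zero:
  "\<forall>(\<omega>, x, y) \<in> set (nodesN \<theta>). y * (G - K * x\<^sup>2 - B * y\<^sup>2) = 0"
  using nodes12_conic by (auto simp: nodesN_def nodes_sq)

end

lemma cubic_in_bpoly:
  "(\<lambda>x y. y * (a - b * x\<^sup>2 - c * y\<^sup>2)) \<in> bpoly 3" "(\<lambda>x y. x * (a - b * y\<^sup>2 - c * x\<^sup>2)) \<in> bpoly 3"
proof -
  have "(\<lambda>x y. (a * x ^ 0 * y ^ 1 + (- b) * x ^ 2 * y ^ 1) + (- c) * x ^ 0 * y ^ 3) \<in> bpoly 3"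
    by (intro bpoly_add bpoly_monom) auto
  then show "(\<lambda>x y. y * (a - b * x\<^sup>2 - c * y\<^sup>2)) \<in> bpoly 3"
    by (simp add: algebra_simps power2_eq_square power3_eq_cube)
  have "(\<lambda>x y. (a * x ^ 1 * y ^ 0 + (- b) * x ^ 1 * y ^ 2) + (- c) * x ^ 3 * y ^ 0) \<in> bpoly 3"
    by (intro bpoly_add bpoly_monom) auto
  then show "(\<lambda>x y. x * (a - b * y\<^sup>2 - c * x\<^sup>2)) \<in> bpoly 3"
    by (simp add: algebra_simps power2_eq_square power3_eq_cube)
qed

lemma (in nodes_negative) negative_case:
  "nodes12N_defined \<theta>" "nodes34_defined (resN \<theta>)"
  "\<forall>k\<in>{6, 7}. symmetric_OCAD \<theta> k (wbar \<theta>) (nodesN \<theta>)"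
  "\<forall>k\<in>{6, 7}. max_bdry_weight \<theta> k = wbar \<theta> \<and>
      ereal (max_bdry_weight \<theta> k) = phi_star \<theta> (bpoly_nonneg k) \<and>
      phi_star \<theta> (bpoly_nonneg k) = phi_star \<theta> (bpoly_squares 3) \<and>
      (\<exists>q\<in>bpoly 3. q \<noteq> (\<lambda>x y. 0) \<and> critical_positive_poly \<theta> k (\<lambda>x y. (q x y)\<^sup>2))"
proof -
  show "nodes12N_defined \<theta>" by (rule nodes12)
  show "nodes34_defined (resN \<theta>)" by (rule residual_quadrature)
  let ?q = "\<lambda>x y. y * (G - K * x\<^sup>2 - B * y\<^sup>2)"
  have feas: "feasible_symmetric_CAD \<theta> 7 (wbar \<theta>) (nodesN \<theta>)"
    using moments by (intro feasible_from_moments wbar_pos nodes_valid) (simp add: mom_def)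
  have \<theta>1: "\<theta> \<in> {-1..1}" using \<theta> t by simp
  have van: "\<forall>(\<omega>, x, y) \<in> set (nodesN \<theta>). sym_avg (\<lambda>x y. (?q x y)\<^sup>2) x y = 0"
    using sym_avg_conic_zero by (fastforce simp: sym_avg_def)
  have nz: "?q 0 (1 / 2) \<noteq> 0"
    using conic_nonzero by (simp add: power2_eq_square)
  note * = optimal_CAD_6_7[OF \<theta>1 feas cubic_in_bpoly(1) _ _ nz van]
  show "\<forall>k\<in>{6, 7}. symmetric_OCAD \<theta> k (wbar \<theta>) (nodesN \<theta>)"
    by (rule *(1)) auto
  show "\<forall>k\<in>{6, 7}. max_bdry_weight \<theta> k = wbar \<theta> \<and>
      ereal (max_bdry_weight \<theta> k) = phi_star \<theta> (bpoly_nonneg k) \<and>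
      phi_star \<theta> (bpoly_nonneg k) = phi_star \<theta> (bpoly_squares 3) \<and>
      (\<exists>q\<in>bpoly 3. q \<noteq> (\<lambda>x y. 0) \<and> critical_positive_poly \<theta> k (\<lambda>x y. (q x y)\<^sup>2))"
    by (rule *(2)) auto
qed

lemma nodes_negativeE:
  assumes "\<theta> \<in> {-1..0}"
  obtains t h where "nodes_negative t h \<theta>"
proof -
  have abs: "\<bar>\<theta>\<bar> = - \<theta>" "\<bar>\<theta>\<bar> \<le> 1" using assms by auto
  note shift = wbar_shift[OF abs(2), unfolded abs(1)]
  have "nodes_negative (- \<theta>) (wbar_inv \<theta> - 11 - 9 * - \<theta>) \<theta>"
    by (intro nodes_negative.intro quartic_root.intro nodes_negative_axioms.intro shift)
      (use assms in auto)
  then show ?thesis ..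
qed

section \<open>The case \<theta> in [0,1] by exchanging x and y\<close>

lemma wbar_minus: "wbar (- \<theta>) = wbar \<theta>"
  by (simp add: wbar_def wbar_inv_def wbar_rad_def wbar_arg_def)

lemma mom_swap: "mom \<theta> i j = mom (- \<theta>) j i"
  by (simp add: mom_def wbar_minus algebra_simps)

lemma swap_nodes12:
  "beta1P \<theta> = beta1N (- \<theta>)" "beta2P \<theta> = beta3N (- \<theta>)" "beta3P \<theta> = beta2N (- \<theta>)"
  "X1P \<theta> = Y1N (- \<theta>)" "Y1P \<theta> = X1N (- \<theta>)" "X2P \<theta> = Y2N (- \<theta>)" "Y2P \<theta> = X2N (- \<theta>)"
  "omega1P \<theta> = omega1N (- \<theta>)" "omega2P \<theta> = omega2N (- \<theta>)"
  "x1P \<theta> = y1N (- \<theta>)" "y1P \<theta> = x1N (- \<theta>)" "x2P \<theta> = y2N (- \<theta>)" "y2P \<theta> = x2N (- \<theta>)"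
proof -
  note m = mom_swap[of \<theta>]
  show beta: "beta1P \<theta> = beta1N (- \<theta>)" "beta2P \<theta> = beta3N (- \<theta>)" "beta3P \<theta> = beta2N (- \<theta>)"
    unfolding beta1P_def beta2P_def beta3P_def beta1N_def beta2N_def beta3N_def m by simp_all
  show X: "X1P \<theta> = Y1N (- \<theta>)" "Y1P \<theta> = X1N (- \<theta>)" "X2P \<theta> = Y2N (- \<theta>)" "Y2P \<theta> = X2N (- \<theta>)"
    unfolding X1P_def Y1P_def X2P_def Y2P_def X1N_def Y1N_def X2N_def Y2N_def beta m by simp_all
  show x: "x1P \<theta> = y1N (- \<theta>)" "y1P \<theta> = x1N (- \<theta>)" "x2P \<theta> = y2N (- \<theta>)" "y2P \<theta> = x2N (- \<theta>)"
    unfolding x1P_def y1P_def x2P_def y2P_def x1N_def y1N_def x2N_def y2N_def X by simp_all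
  show "omega1P \<theta> = omega1N (- \<theta>)" "omega2P \<theta> = omega2N (- \<theta>)"
    unfolding omega1P_def omega2P_def omega1N_def omega2N_def x beta m by simp_all
qed

lemma resP_swap: "resP \<theta> = resN (- \<theta>)"
  by (auto simp: resP_def resN_def swap_nodes12 mom_swap[of \<theta>])

lemma nodesP_swap: "nodesP \<theta> = map (\<lambda>(\<omega>, x, y). (\<omega>, y, x)) (nodesN (- \<theta>))"
  by (simp add: nodesP_def nodesN_def swap_nodes12 resP_swap)

lemma positive_case:
  assumes "\<theta> \<in> {0..1}"
  shows "nodes12P_defined \<theta>" "nodes34_defined (resP \<theta>)"
  "\<forall>k\<in>{6, 7}. symmetric_OCAD \<theta> k (wbar \<theta>) (nodesP \<theta>)"
  "\<forall>k\<in>{6, 7}. max_bdry_weight \<theta> k = wbar \<theta> \<and>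
      ereal (max_bdry_weight \<theta> k) = phi_star \<theta> (bpoly_nonneg k) \<and>
      phi_star \<theta> (bpoly_nonneg k) = phi_star \<theta> (bpoly_squares 3) \<and>
      (\<exists>q\<in>bpoly 3. q \<noteq> (\<lambda>x y. 0) \<and> critical_positive_poly \<theta> k (\<lambda>x y. (q x y)\<^sup>2))"
proof -
  have "- \<theta> \<in> {-1..0}" using assms by auto
  then obtain t h where "nodes_negative t h (- \<theta>)" by (rule nodes_negativeE)
  then interpret N: nodes_negative t h "- \<theta>" .
  show "nodes12P_defined \<theta>"
    using N.nodes12 unfolding nodes12P_defined_def nodes12N_defined_def swap_nodes12 mom_swap[of \<theta>]
    by blast
  show "nodes34_defined (resP \<theta>)"
    unfolding resP_swap by (rule N.residual_quadrature)
  have feas: "feasible_symmetric_CAD \<theta> 7 (wbar \<theta>) (nodesP \<theta>)"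
  proof (rule feasible_from_moments)
    show "wbar \<theta> > 0" using N.wbar_pos by (simp add: wbar_minus)
    show "\<forall>(\<omega>, x, y) \<in> set (nodesP \<theta>). \<omega> > 0 \<and> x \<in> {0..1} \<and> y \<in> {0..1}"
      using N.nodes_valid by (auto simp: nodesP_swap)
    fix i j :: nat assume ij: "even i" "even j" "i + j \<le> 7"
    have "mom \<theta> i j = (\<Sum>(\<omega>, x, y)\<leftarrow>nodesN (- \<theta>). \<omega> * (x ^ j * y ^ i))"
      unfolding mom_swap[of \<theta>] using ij by (intro N.moments) auto
    also have "\<dots> = (\<Sum>(\<omega>, x, y)\<leftarrow>nodesP \<theta>. \<omega> * (x ^ i * y ^ j))"
      unfolding nodesP_swap map_map
      by (intro arg_cong[where f = sum_list] map_cong) (auto simp: mult.commute)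
    finally show "1 / ((real i + 1) * (real j + 1))
        - wbar \<theta> * ((1 + \<theta>) / (1 + real j) + (1 - \<theta>) / (1 + real i))
        = (\<Sum>(\<omega>, x, y)\<leftarrow>nodesP \<theta>. \<omega> * (x ^ i * y ^ j))"
      by (simp add: mom_def)
  qed
  let ?q = "\<lambda>x y. x * (N.G - N.K * y\<^sup>2 - N.B * x\<^sup>2)"
  have \<theta>1: "\<theta> \<in> {-1..1}" using assms by simp
  have van: "\<forall>(\<omega>, x, y) \<in> set (nodesP \<theta>). sym_avg (\<lambda>x y. (?q x y)\<^sup>2) x y = 0"
    using N.sym_avg_conic_zero unfolding nodesP_swap by (fastforce simp: sym_avg_def)
  have nz: "?q (1 / 2) 0 \<noteq> 0"
    using N.conic_nonzero by (simp add: power2_eq_square)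
  note * = optimal_CAD_6_7[OF \<theta>1 feas cubic_in_bpoly(2) _ _ nz van]
  show "\<forall>k\<in>{6, 7}. symmetric_OCAD \<theta> k (wbar \<theta>) (nodesP \<theta>)"
    by (rule *(1)) auto
  show "\<forall>k\<in>{6, 7}. max_bdry_weight \<theta> k = wbar \<theta> \<and>
      ereal (max_bdry_weight \<theta> k) = phi_star \<theta> (bpoly_nonneg k) \<and>
      phi_star \<theta> (bpoly_nonneg k) = phi_star \<theta> (bpoly_squares 3) \<and>
      (\<exists>q\<in>bpoly 3. q \<noteq> (\<lambda>x y. 0) \<and> critical_positive_poly \<theta> k (\<lambda>x y. (q x y)\<^sup>2))"
    by (rule *(2)) auto
qed

theorem theorem5p17:
  fixes \<theta> :: real
  assumes "\<theta> \<in> {-1..1}"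
  shows
    "wbar_defined \<theta> \<and>
     (\<theta> \<in> {-1..0} \<longrightarrow>
        nodes12N_defined \<theta> \<and> nodes34_defined (resN \<theta>) \<and>
        (\<forall>k\<in>{6, 7}. symmetric_OCAD \<theta> k (wbar \<theta>) (nodesN \<theta>))) \<and>
     (\<theta> \<in> {0..1} \<longrightarrow>
        nodes12P_defined \<theta> \<and> nodes34_defined (resP \<theta>) \<and>
        (\<forall>k\<in>{6, 7}. symmetric_OCAD \<theta> k (wbar \<theta>) (nodesP \<theta>))) \<and>
     (\<forall>k\<in>{6, 7}.
        max_bdry_weight \<theta> k = wbar \<theta> \<and>
        ereal (max_bdry_weight \<theta> k) = phi_star \<theta> (bpoly_nonneg k) \<and>
        phi_star \<theta> (bpoly_nonneg k) = phi_star \<theta> (bpoly_squares 3) \<and>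
        (\<exists>q\<in>bpoly 3. q \<noteq> (\<lambda>x y. 0) \<and> critical_positive_poly \<theta> k (\<lambda>x y. (q x y)\<^sup>2)))"
proof (intro conjI impI)
  show "wbar_defined \<theta>" using assms by (intro wbar_shift) auto
next
  assume "\<theta> \<in> {-1..0}"
  then obtain t h where "nodes_negative t h \<theta>" by (rule nodes_negativeE)
  then interpret nodes_negative t h \<theta> .
  show "nodes12N_defined \<theta>" "nodes34_defined (resN \<theta>)"
    "\<forall>k\<in>{6, 7}. symmetric_OCAD \<theta> k (wbar \<theta>) (nodesN \<theta>)"
    by (rule negative_case)+
next
  assume "\<theta> \<in> {0..1}"
  note positive_case[OF this]
  then show "nodes12P_defined \<theta>" "nodes34_defined (resP \<theta>)"
    "\<forall>k\<in>{6, 7}. symmetric_OCAD \<theta> k (wbar \<theta>) (nodesP \<theta>)"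
    by blast+
next
  show "\<forall>k\<in>{6, 7}.
        max_bdry_weight \<theta> k = wbar \<theta> \<and>
        ereal (max_bdry_weight \<theta> k) = phi_star \<theta> (bpoly_nonneg k) \<and>
        phi_star \<theta> (bpoly_nonneg k) = phi_star \<theta> (bpoly_squares 3) \<and>
        (\<exists>q\<in>bpoly 3. q \<noteq> (\<lambda>x y. 0) \<and> critical_positive_poly \<theta> k (\<lambda>x y. (q x y)\<^sup>2))"
  proof (cases "\<theta> \<le> 0")
    case True
    then have "\<theta> \<in> {-1..0}" using assms by auto
    then obtain t h where "nodes_negative t h \<theta>" by (rule nodes_negativeE)
    then interpret nodes_negative t h \<theta> .
    show ?thesis by (rule negative_case)
  next
    case False
    then show ?thesis using assms by (intro positive_case) auto
  qed
qed

end
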